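(* There exists a pacing function $\mu:\Theta\to\mathbb{R}_{\ge 0}$ such that the value-pacing-based strategy $\beta^\mu:\Theta\times A\to\mathbb{R}_{\ge0}$ is a Symmetric First Price Equilibrium (SFPE).
   Context: Setting. Fix integers $n\ge 2$ (buyers per auction) and $d\ge 2$, and constants $U>0$, $B_{\min}>0$. Buyer types are $\theta=(w,B)\in\Theta:=(0,U)^d\times(B_{\min},U)$ ($w$ is the weight vector, $B$ the budget); $\Theta_w:=(0,U)^d$. Item types (contexts) are $\alpha\in A\subset\mathbb{R}^d_{+}$ (the strictly positive orthant); all sets carry the Lebesgue $\sigma$-algebra. $F$ is a probability distribution on $A$ with a density and $G$ is a probability distribution on $\Theta$ with a density; $G_w$ denotes the marginal of $w$ under $G$. Buyer $(w,B)$ values item $\alpha$ at $w^T\alpha$; $\omega>0$ is a constant with $w^T\alpha\le\omega$ for all $w\in\Theta_w$, $\alpha\in A$. Reserve prices are given by a measurable $r:A\to(0,\infty)$. In an auction, $\alpha\sim F$ and the $n$ buyer types are i.i.d. draws from $G$, independent of $\alpha$. Pacing objects. A pacing function is a measurable $\mu:\Theta\to\mathbb{R}_{\ge0}$. For $\alpha\in A$, $\lambda^\mu_\alpha$ is the distribution of the paced value $w^T\alpha/(1+\mu(w,B))$ when $(w,B)\sim G$, and $H^\mu_\alpha$ is the distribution of the maximum of $n-1$ i.i.d. draws from $\lambda^\mu_\alpha$; write $H^\mu_\alpha(x):=H^\mu_\alpha((-\infty,x])=\lambda^\mu_\alpha((-\infty,x])^{n-1}$. Define $\sigma^\mu_\alpha:\mathbb{R}_{\ge0}\to\mathbb{R}_{\ge0}$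 by $\sigma^\mu_\alpha(x)=x$ if $x<r(\alpha)$; and for $x\ge r(\alpha)$, $\sigma^\mu_\alpha(x)=x-\int_{r(\alpha)}^x \frac{H^\mu_\alpha(s)}{H^\mu_\alpha(x)}ds$ if $H^\mu_\alpha(x)>0$, and $\sigma^\mu_\alpha(x)=r(\alpha)$ if $H^\mu_\alpha(x)=0$. The value-pacing-based strategy is $\beta^\mu(w,B,\alpha):=\sigma^\mu_\alpha\big(w^T\alpha/(1+\mu(w,B))\big)$. SFPE. A strategy $\beta^*:\Theta\times A\to\mathbb{R}_{\ge0}$ is a Symmetric First Price Equilibrium if for $G$-almost every $(w,B)$, the function $\alpha\mapsto\beta^*(w,B,\alpha)$ is an optimal solution of $\max_{b:A\to\mathbb{R}_{\ge0}}\ \mathbb{E}_{\alpha,\{\theta_i\}_{i=1}^{n-1}}\big[(w^T\alpha-b(\alpha))\,\mathbf 1\{b(\alpha)\ge\max(r(\alpha),\{\beta^*(\theta_i,\alpha)\}_i)\}\big]$ subject to $\mathbb{E}_{\alpha,\{\theta_i\}}\big[b(\alpha)\,\mathbf 1\{b(\alpha)\ge\max(r(\alpha),\{\beta^*(\theta_i,\alpha)\}_i)\}\big]\le B$, where $\alpha\sim F$ and $\theta_1,\dots,\theta_{n-1}\sim G$ are i.i.d. and independent, and the maximum is over measurable $b$. *)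

theory Defs
  imports "HOL-Probability.Probability"
begin

(* Buyer types theta = (w, B) :: (real^'d) \<times> real ; item types alpha :: real^'d *)

definition Theta_w :: "real \<Rightarrow> (real^'d::finite) set" where
  "Theta_w U = {w. \<forall>i. 0 < w $ i \<and> w $ i < U}"

definition Theta :: "real \<Rightarrow> real \<Rightarrow> ((real^'d::finite) \<times> real) set" where
  "Theta U Bmin = {(w, B). w \<in> Theta_w U \<and> Bmin < B \<and> B < U}"

definition paced_value ::
  "((real^'d::finite) \<times> real \<Rightarrow> real) \<Rightarrow> real^'d \<Rightarrow> (real^'d) \<times> real \<Rightarrow> real" where
  "paced_value \<mu> \<alpha> \<theta> = (fst \<theta> \<bullet> \<alpha>) / (1 + \<mu> \<theta>)"

definition paced_dist ::
  "((real^'d::finite) \<times> real) measure \<Rightarrow> ((real^'d) \<times> real \<Rightarrow> real) \<Rightarrow> real^'d \<Rightarrow> real measure" where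
  "paced_dist G \<mu> \<alpha> = distr G borel (paced_value \<mu> \<alpha>)"

definition H_cdf ::
  "nat \<Rightarrow> ((real^'d::finite) \<times> real) measure \<Rightarrow> ((real^'d) \<times> real \<Rightarrow> real) \<Rightarrow> real^'d \<Rightarrow> real \<Rightarrow> real" where
  "H_cdf n G \<mu> \<alpha> x = (measure (paced_dist G \<mu> \<alpha>) {..x}) ^ (n - 1)"

definition sigma_fn ::
  "nat \<Rightarrow> ((real^'d::finite) \<times> real) measure \<Rightarrow> ((real^'d) \<times> real \<Rightarrow> real)
    \<Rightarrow> (real^'d \<Rightarrow> real) \<Rightarrow> real^'d \<Rightarrow> real \<Rightarrow> real" where
  "sigma_fn n G \<mu> r \<alpha> x =
     (if x < r \<alpha> then x
      else if H_cdf n G \<mu> \<alpha> x > 0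
        then x - (LBINT s=r \<alpha>..x. H_cdf n G \<mu> \<alpha> s / H_cdf n G \<mu> \<alpha> x)
        else r \<alpha>)"

definition vp_strategy ::
  "nat \<Rightarrow> ((real^'d::finite) \<times> real) measure \<Rightarrow> ((real^'d) \<times> real \<Rightarrow> real)
    \<Rightarrow> (real^'d \<Rightarrow> real) \<Rightarrow> (real^'d) \<times> real \<Rightarrow> real^'d \<Rightarrow> real" where
  "vp_strategy n G \<mu> r \<theta> \<alpha> = sigma_fn n G \<mu> r \<alpha> (paced_value \<mu> \<alpha> \<theta>)"

(* joint law of the item and the n-1 competing buyers: alpha ~ F, theta_i ~ G iid, independent *)
definition auction_space ::
  "nat \<Rightarrow> (real^'d::finite) measure \<Rightarrow> ((real^'d) \<times> real) measure
    \<Rightarrow> ((real^'d) \<times> (nat \<Rightarrow> (real^'d) \<times> real)) measure" where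
  "auction_space n F G = F \<Otimes>\<^sub>M (\<Pi>\<^sub>M i\<in>{..<n-1}. G)"

definition wins ::
  "nat \<Rightarrow> (real^'d::finite \<Rightarrow> real) \<Rightarrow> ((real^'d) \<times> real \<Rightarrow> real^'d \<Rightarrow> real)
    \<Rightarrow> (real^'d \<Rightarrow> real) \<Rightarrow> real^'d \<Rightarrow> (nat \<Rightarrow> (real^'d) \<times> real) \<Rightarrow> bool" where
  "wins n r \<beta> b \<alpha> \<theta>s \<longleftrightarrow> r \<alpha> \<le> b \<alpha> \<and> (\<forall>i<n-1. \<beta> (\<theta>s i) \<alpha> \<le> b \<alpha>)"

definition exp_payment ::
  "nat \<Rightarrow> (real^'d::finite) measure \<Rightarrow> ((real^'d) \<times> real) measure \<Rightarrow> (real^'d \<Rightarrow> real)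
    \<Rightarrow> ((real^'d) \<times> real \<Rightarrow> real^'d \<Rightarrow> real) \<Rightarrow> (real^'d \<Rightarrow> real) \<Rightarrow> ennreal" where
  "exp_payment n F G r \<beta> b =
     (\<integral>\<^sup>+ z. ennreal (if wins n r \<beta> b (fst z) (snd z) then b (fst z) else 0) \<partial>auction_space n F G)"

definition exp_value ::
  "nat \<Rightarrow> (real^'d::finite) measure \<Rightarrow> ((real^'d) \<times> real) measure \<Rightarrow> (real^'d \<Rightarrow> real)
    \<Rightarrow> ((real^'d) \<times> real \<Rightarrow> real^'d \<Rightarrow> real) \<Rightarrow> real^'d \<Rightarrow> (real^'d \<Rightarrow> real) \<Rightarrow> ennreal" where
  "exp_value n F G r \<beta> w b =
     (\<integral>\<^sup>+ z. ennreal (if wins n r \<beta> b (fst z) (snd z) then w \<bullet> fst z else 0) \<partial>auction_space n F G)"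

(* E[ (w^T alpha - b(alpha)) 1{win} ], for bids with finite expected payment *)
definition exp_utility ::
  "nat \<Rightarrow> (real^'d::finite) measure \<Rightarrow> ((real^'d) \<times> real) measure \<Rightarrow> (real^'d \<Rightarrow> real)
    \<Rightarrow> ((real^'d) \<times> real \<Rightarrow> real^'d \<Rightarrow> real) \<Rightarrow> real^'d \<Rightarrow> (real^'d \<Rightarrow> real) \<Rightarrow> real" where
  "exp_utility n F G r \<beta> w b =
     enn2real (exp_value n F G r \<beta> w b) - enn2real (exp_payment n F G r \<beta> b)"

definition feasible_bid ::
  "nat \<Rightarrow> (real^'d::finite) measure \<Rightarrow> ((real^'d) \<times> real) measure \<Rightarrow> (real^'d) set
    \<Rightarrow> (real^'d \<Rightarrow> real) \<Rightarrow> ((real^'d) \<times> real \<Rightarrow> real^'d \<Rightarrow> real) \<Rightarrow> real \<Rightarrow> (real^'d \<Rightarrow> real) \<Rightarrow> bool" where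
  "feasible_bid n F G A r \<beta> B b \<longleftrightarrow>
     b \<in> borel_measurable lebesgue \<and> (\<forall>\<alpha>\<in>A. 0 \<le> b \<alpha>) \<and>
     exp_payment n F G r \<beta> b \<le> ennreal B"

definition is_SFPE ::
  "nat \<Rightarrow> (real^'d::finite) measure \<Rightarrow> ((real^'d) \<times> real) measure \<Rightarrow> (real^'d) set
    \<Rightarrow> (real^'d \<Rightarrow> real) \<Rightarrow> ((real^'d) \<times> real \<Rightarrow> real^'d \<Rightarrow> real) \<Rightarrow> bool" where
  "is_SFPE n F G A r \<beta> \<longleftrightarrow>
     (AE \<theta> in G.
        feasible_bid n F G A r \<beta> (snd \<theta>) (\<beta> \<theta>) \<and>
        (\<forall>b. feasible_bid n F G A r \<beta> (snd \<theta>) b \<longrightarrow>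
             exp_utility n F G r \<beta> (fst \<theta>) b \<le> exp_utility n F G r \<beta> (fst \<theta>) (\<beta> \<theta>)))"

end

theory Submission
  imports Defs
begin

text \<open>
  A buyer's dual problem depends on the rivals only through the mean surplus
  \<open>\<Phi>(x) = E[\<integral> H\<^sub>\<alpha>(s) ds]\<close>, the inner integral running over \<open>r \<alpha> \<le> s \<le> x \<bullet> \<alpha>\<close>: the buyer \<open>(w, B)\<close>
  minimises \<open>(1 + t) \<Phi>(w / (1 + t)) + t B\<close> over \<open>t\<close>.  So instead of pacing functions one looks for a
  fixed point of \<open>\<Phi> \<mapsto> \<mu> \<mapsto> \<Phi>\<close> on the convex compact set of bounded Lipschitz functions.  The map is
  continuous for pointwise convergence: by monotonicity in \<open>B\<close> the minimiser is unique off countably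
  many budgets for each \<open>w\<close>, and for almost every \<open>\<alpha>\<close> the paced value has no atoms, since
  two buyers with non-proportional weights tie only on a hyperplane of items (this is where \<open>d \<ge> 2\<close>
  enters).  Schauder's theorem on this set is obtained from Kuhn's combinatorial lemma on the Hilbert cube.

  At a fixed point, bidding with another multiplier \<open>s\<close> bounds the dual objective at \<open>t\<close> from below, which
  yields \<open>(s - t)(B - P s) \<ge> 0\<close> for the expected payment \<open>P s\<close>; letting \<open>s \<rightarrow> t\<close> gives
  complementary slackness without differentiating the dual, and weak duality gives optimality.
\<close>

section \<open>Fixed points on the Hilbert cube\<close>

text \<open>For a fixed multiplier \<open>t\<close> the Lagrangian of a buyer at one item is
  \<open>1 + t\<close> times the utility in an unconstrained first-price auction with value
  \<open>w \<bullet> \<alpha> / (1 + t)\<close>. By the envelope formula its maximum is the integral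
  of the winning probability, which is where \<Phi> comes from. Pacing functions are merely
  measurable and have no compactness for pointwise convergence, whereas \<Phi> has range in
  \<open>{0..\<omega>}\<close> and Lipschitz constant \<open>2 * \<omega> / U\<close> whatever
  pacing function produced it. The minimiser may jump with its data, so it converges only for almost
  every buyer type; this suffices because \<Phi> integrates over types. The absence of atoms serves
  twice: for the convergence of distribution functions, and for the continuity of the expected
  payment in the multiplier. The best-response bounds at a single item, by contrast, hold for
  arbitrary distributions.\<close>

lemma cube_seq_compact:
  fixes Y :: "nat \<Rightarrow> nat \<Rightarrow> real"
  assumes "\<And>k i. Y k i \<in> {0..C}"
  obtains y \<phi> where "strict_mono (\<phi> :: nat \<Rightarrow> nat)" "\<And>i. y i \<in> {0..C}"
    "\<And>i. (\<lambda>k. Y (\<phi> k) i) \<longlonglongrightarrow> y i"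
proof -
  let ?Q = "PiE UNIV (\<lambda>_. {0..C}) :: (nat \<Rightarrow> real) set"
  have "compactin (product_topology (\<lambda>_. euclidean) UNIV) ?Q"
    by (subst compactin_PiE) (auto simp: compactin_euclidean_iff)
  then have "compact ?Q"
    by (subst (asm) euclidean_product_topology) (simp only: compactin_euclidean_iff)
  then have sc: "seq_compact ?Q"
    by (simp add: compact_eq_seq_compact_metric)
  have "\<forall>k. Y k \<in> ?Q"
    using assms by auto
  then obtain y \<phi> where y: "y \<in> ?Q" "strict_mono (\<phi> :: nat \<Rightarrow> nat)" "(Y \<circ> \<phi>) \<longlonglongrightarrow> y"
    by (rule seq_compactE[OF sc])
  have "(\<lambda>k. Y (\<phi> k) i) \<longlonglongrightarrow> y i" for i
  proof -
    have "continuous_on UNIV (\<lambda>z::nat\<Rightarrow>real. z i)"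
      by simp
    then have "isCont (\<lambda>z::nat\<Rightarrow>real. z i) y"
      by (simp only: continuous_on_eq_continuous_at[OF open_UNIV] UNIV_I ball_UNIV)
    from isCont_tendsto_compose[OF this y(3)] show ?thesis by (simp add: o_def)
  qed
  with y show ?thesis by (intro that[of \<phi> y]) (auto simp: PiE_iff)
qed

text \<open>Kuhn's lemma on a grid of mesh \<open>C / N\<close> in the first \<open>N\<close>
  coordinates, all others frozen at 0. Using one \<open>N\<close> for dimension and mesh lets a
  single limit remove both approximations. Without continuity the two opposite inequalities hold at
  different points, hence a pair \<open>u\<close>, \<open>v\<close> for each coordinate.\<close>

lemma hilbert_cube_approx_fixpoint:
  fixes S :: "(nat \<Rightarrow> real) \<Rightarrow> nat \<Rightarrow> real"
  assumes C: "C > 0"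
    and range: "\<And>y i. (\<And>j. y j \<in> {0..C}) \<Longrightarrow> S y i \<in> {0..C}"
    and N: "N > 0"
  shows "\<exists>y. (\<forall>j. y j \<in> {0..C}) \<and>
    (\<forall>i<N. \<exists>u v. (\<forall>j. u j \<in> {0..C} \<and> v j \<in> {0..C} \<and> \<bar>u j - y j\<bar> \<le> C / N \<and> \<bar>v j - y j\<bar> \<le> C / N) \<and>
       u i \<le> S u i \<and> S v i \<le> v i)"
proof -
  define pt where "pt q = (\<lambda>j. if j < N then C * real (q j) / N else 0)" for q :: "nat \<Rightarrow> nat"
  \<comment> \<open>The clause \<open>q i < N\<close> forces label 1 on the top face, as Kuhn's
    lemma demands. On that face \<open>S (pt q) i \<le> C = pt q i\<close>, so label 1 still means
    that \<open>S\<close> does not increase the coordinate.\<close>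
  define label where
    "label q i = (if pt q i \<le> S (pt q) i \<and> q i < N then 0 else 1 :: nat)" for q :: "nat \<Rightarrow> nat" and i
  have pt: "pt q j \<in> {0..C}" if "\<forall>i<N. q i \<le> N" for q j
    using that C N by (auto simp: pt_def divide_simps mult_left_mono)
  have pt_0: "pt q i = 0" if "q i = 0" for q i
    using that by (auto simp: pt_def)
  have pt_N: "pt q i = C" if "q i = N" "i < N" for q i
    using that N by (auto simp: pt_def)
  obtain q where q: "\<forall>i<N. q i < N" and
     rs: "\<forall>i<N. \<exists>r s. (\<forall>j<N. q j \<le> r j \<and> r j \<le> q j + 1) \<and> (\<forall>j<N. q j \<le> s j \<and> s j \<le> q j + 1) \<and> label r i \<noteq> label s i"
  proof (rule kuhn_lemma[of N N label])
    show "\<forall>x. (\<forall>i<N. x i \<le> N) \<longrightarrow> (\<forall>i<N. x i = 0 \<longrightarrow> label x i = 0)"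
      using range pt pt_0 N by (auto simp: label_def)
  qed (use N in \<open>auto simp: label_def\<close>)
  have close: "\<bar>pt r j - pt q j\<bar> \<le> C / N" if "\<forall>j<N. q j \<le> r j \<and> r j \<le> q j + 1" for r j
  proof (cases "j < N")
    case True
    then have "pt r j - pt q j = C * (real (r j) - real (q j)) / N"
      by (simp add: pt_def algebra_simps diff_divide_distrib)
    moreover have "real (q j) \<le> real (r j)" "real (r j) \<le> real (q j) + 1"
      using that True by (force simp: of_nat_mono)+
    ultimately show ?thesis
      using C N by (simp add: divide_right_mono)
  qed (use C in \<open>simp add: pt_def\<close>)
  have small: "\<forall>j<N. r j \<le> N" if "\<forall>j<N. q j \<le> r j \<and> r j \<le> q j + 1" for r
    using that q by (metis Suc_eq_plus1 Suc_leI order_trans)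
  have lab0: "pt r i \<le> S (pt r) i" if "label r i = 0" for r i
    using that by (auto simp: label_def split: if_splits)
  have lab1: "S (pt r) i \<le> pt r i" if "label r i \<noteq> 0" "\<forall>j<N. r j \<le> N" "i < N" for r i
    using that range[of "pt r" i] pt[of r] pt_N[of r i]
    by (auto simp: label_def split: if_splits)
  have key: "\<exists>u v. (\<forall>j. u j \<in> {0..C} \<and> v j \<in> {0..C} \<and> \<bar>u j - pt q j\<bar> \<le> C / N \<and> \<bar>v j - pt q j\<bar> \<le> C / N) \<and>
       u i \<le> S u i \<and> S v i \<le> v i"
    if "(\<forall>j<N. q j \<le> r j \<and> r j \<le> q j + 1)" "(\<forall>j<N. q j \<le> s j \<and> s j \<le> q j + 1)"
      "label r i = 0" "label s i \<noteq> 0" "i < N" for r s i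
    using that lab0[of r i] lab1[of s i] close small pt
    by (intro exI[of _ "pt r"] exI[of _ "pt s"]) auto
  show ?thesis
  proof (rule exI[of _ "pt q"], intro conjI allI impI)
    show "pt q j \<in> {0..C}" for j
      using pt q by (auto simp: less_imp_le)
    fix i assume i: "i < N"
    from rs i obtain r s where
      r: "\<forall>j<N. q j \<le> r j \<and> r j \<le> q j + 1" and s: "\<forall>j<N. q j \<le> s j \<and> s j \<le> q j + 1"
      and ne: "label r i \<noteq> label s i"
      by blast
    show "\<exists>u v. (\<forall>j. u j \<in> {0..C} \<and> v j \<in> {0..C} \<and> \<bar>u j - pt q j\<bar> \<le> C / N \<and> \<bar>v j - pt q j\<bar> \<le> C / N) \<and>
       u i \<le> S u i \<and> S v i \<le> v i"
    proof (cases "label r i = 0")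
      case True
      with ne show ?thesis using key[OF r s _ _ i] by simp
    next
      case False
      with ne have "label s i = 0" by (auto simp: label_def split: if_splits)
      with False show ?thesis using key[OF s r _ _ i] by simp
    qed
  qed
qed

text \<open>The witnesses \<open>u\<close>, \<open>v\<close> of a fixed coordinate \<open>i\<close>
  have the same limit \<open>y\<close> as the grid points, since the mesh vanishes. Continuity of
  \<open>S\<close> then turns their inequalities into
  \<open>y i \<le> S y i \<le> y i\<close>.\<close>

theorem hilbert_cube_fixpoint:
  fixes S :: "(nat \<Rightarrow> real) \<Rightarrow> nat \<Rightarrow> real"
  assumes C: "C > 0"
    and range: "\<And>y i. (\<And>j. y j \<in> {0..C}) \<Longrightarrow> S y i \<in> {0..C}"
    and cont: "\<And>Y y i. (\<And>k j. Y k j \<in> {0..C}) \<Longrightarrow> (\<And>j. y j \<in> {0..C}) \<Longrightarrow>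
      (\<And>j. (\<lambda>k. Y k j) \<longlonglongrightarrow> y j) \<Longrightarrow> (\<lambda>k. S (Y k) i) \<longlonglongrightarrow> S y i"
  obtains y where "\<And>j. y j \<in> {0..C}" "S y = y"
proof -
  define R where "R N y u v \<longleftrightarrow> (\<forall>j. u j \<in> {0..C} \<and> v j \<in> {0..C} \<and> \<bar>u j - y j\<bar> \<le> C / Suc N \<and> \<bar>v j - y j\<bar> \<le> C / Suc N)"
    for N and y u v :: "nat \<Rightarrow> real"
  have "\<exists>y. (\<forall>j. y j \<in> {0..C}) \<and> (\<forall>i<Suc N. \<exists>u v. R N y u v \<and> u i \<le> S u i \<and> S v i \<le> v i)" for N
    unfolding R_def by (rule hilbert_cube_approx_fixpoint[where S=S and N="Suc N", OF C range]) auto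
  then obtain Y where Y: "\<And>N j. Y N j \<in> {0..C}" and
     *: "\<And>N. \<forall>i<Suc N. \<exists>u v. R N (Y N) u v \<and> u i \<le> S u i \<and> S v i \<le> v i"
    by metis
  have "\<forall>N i. \<exists>u v. i < Suc N \<longrightarrow> R N (Y N) u v \<and> u i \<le> S u i \<and> S v i \<le> v i"
  proof (intro allI)
    fix N i
    show "\<exists>u v. i < Suc N \<longrightarrow> R N (Y N) u v \<and> u i \<le> S u i \<and> S v i \<le> v i"
      using *[of N] by (cases "i < Suc N") auto
  qed
  then obtain u v where
     uv0: "\<And>N i. i<Suc N \<Longrightarrow> R N (Y N) (u N i) (v N i)" and
     uS: "\<And>N i. i<Suc N \<Longrightarrow> u N i i \<le> S (u N i) i" and
     vS: "\<And>N i. i<Suc N \<Longrightarrow> S (v N i) i \<le> v N i i"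
    by metis
  have uv: "u N i j \<in> {0..C} \<and> v N i j \<in> {0..C} \<and>
        \<bar>u N i j - Y N j\<bar> \<le> C / Suc N \<and> \<bar>v N i j - Y N j\<bar> \<le> C / Suc N" if "i < Suc N" for N i j
    using uv0[OF that] by (simp add: R_def)
  obtain y \<phi> where \<phi>: "strict_mono (\<phi> :: nat \<Rightarrow> nat)" and y: "\<And>i. y i \<in> {0..C}"
    and lim: "\<And>i. (\<lambda>k. Y (\<phi> k) i) \<longlonglongrightarrow> y i"
    by (rule cube_seq_compact[where Y=Y, OF Y]) blast
  have "S y i = y i" for i
  proof -
    \<comment> \<open>The shift by \<open>i\<close> puts coordinate \<open>i\<close> among the
      controlled ones from the start, since \<open>\<phi> (k + i) \<ge> k + i\<close>.\<close>
    define \<psi> where "\<psi> k = \<phi> (k + i)" for k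
    have sm: "strict_mono \<psi>"
      using \<phi> by (auto simp: strict_mono_def \<psi>_def)
    have i: "i < Suc (\<psi> k)" for k
      using seq_suble[OF \<phi>, of "k + i"] by (simp add: \<psi>_def)
    have limY: "(\<lambda>k. Y (\<psi> k) j) \<longlonglongrightarrow> y j" for j
      unfolding \<psi>_def by (rule LIMSEQ_ignore_initial_segment[OF lim])
    have C0: "(\<lambda>k. C / Suc (\<psi> k)) \<longlonglongrightarrow> 0"
      using LIMSEQ_subseq_LIMSEQ[OF lim_const_over_n[THEN LIMSEQ_Suc] sm, of C] by (simp add: o_def)
    have near: "(\<lambda>k. a k j) \<longlonglongrightarrow> y j"
      if "\<And>k j. \<bar>a k j - Y (\<psi> k) j\<bar> \<le> C / Suc (\<psi> k)" for a :: "nat \<Rightarrow> nat \<Rightarrow> real" and j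
    proof -
      have "(\<lambda>k. a k j - Y (\<psi> k) j) \<longlonglongrightarrow> 0"
        by (rule Lim_null_comparison[OF always_eventually C0]) (use that in simp)
      from tendsto_add[OF this limY[of j]] show ?thesis by simp
    qed
    have u: "(\<lambda>k. u (\<psi> k) i j) \<longlonglongrightarrow> y j" and v: "(\<lambda>k. v (\<psi> k) i j) \<longlonglongrightarrow> y j" for j
      by (rule near; use uv[OF i] in simp)+
    have Su: "(\<lambda>k. S (u (\<psi> k) i) i) \<longlonglongrightarrow> S y i" and Sv: "(\<lambda>k. S (v (\<psi> k) i) i) \<longlonglongrightarrow> S y i"
      by (rule cont; use uv[OF i] y u v in simp)+
    have "y i \<le> S y i"
      by (rule LIMSEQ_le[OF u Su]) (use uS[OF i] in simp)
    moreover have "S y i \<le> y i"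
      by (rule LIMSEQ_le[OF Sv v]) (use vS[OF i] in simp)
    ultimately show ?thesis
      by simp
  qed
  then show ?thesis
    by (intro that[OF y] ext)
qed

section \<open>Fixed points on bounded Lipschitz functions\<close>

definition lip_box :: "real \<Rightarrow> real \<Rightarrow> ('a::metric_space \<Rightarrow> real) set" where
  "lip_box L C = {f. (\<forall>x. f x \<in> {0..C}) \<and> (\<forall>x y. \<bar>f x - f y\<bar> \<le> L * dist x y)}"

text \<open>
  Clamping the value at \<open>p k\<close> between the envelopes of the values at earlier points turns any point of the
  cube into a Lipschitz function.  The envelopes after \<open>k\<close> steps depend on \<open>k\<close> coordinates only, so the
  result is continuous in the product topology, which fails for the plain infimum of
  \<open>y k + L * dist x (p k)\<close>.
\<close>

primrec lip_env :: "real \<Rightarrow> real \<Rightarrow> (nat \<Rightarrow> 'a::metric_space) \<Rightarrow> (nat \<Rightarrow> real) \<Rightarrow> nat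
    \<Rightarrow> ('a \<Rightarrow> real) \<times> ('a \<Rightarrow> real)" where
  "lip_env L C p y 0 = ((\<lambda>x. 0), (\<lambda>x. C))"
| "lip_env L C p y (Suc k) =
    (let l = fst (lip_env L C p y k); h = snd (lip_env L C p y k); z = max (l (p k)) (min (y k) (h (p k)))
     in ((\<lambda>x. max (l x) (z - L * dist x (p k))), (\<lambda>x. min (h x) (z + L * dist x (p k)))))"

abbreviation "lip_lo L C p y k \<equiv> fst (lip_env L C p y k)"
abbreviation "lip_hi L C p y k \<equiv> snd (lip_env L C p y k)"

definition lip_ext :: "real \<Rightarrow> real \<Rightarrow> (nat \<Rightarrow> 'a::metric_space) \<Rightarrow> (nat \<Rightarrow> real) \<Rightarrow> 'a \<Rightarrow> real" where
  "lip_ext L C p y x = (INF k. lip_hi L C p y k x)"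

context
  fixes L C :: real and p :: "nat \<Rightarrow> 'a::metric_space"
  assumes L: "L \<ge> 0" and C: "C \<ge> 0"
begin

text \<open>A cone with apex between \<open>l (p k)\<close> and \<open>h (p k)\<close> can be
  inserted without crossing: \<open>l\<close> and \<open>h\<close> are themselves
  \<open>L\<close>-Lipschitz, so the rising cone stays above \<open>l\<close> and the falling one
  below \<open>h\<close>.\<close>

lemma lip_env_invariant:
  "(\<forall>x. 0 \<le> lip_lo L C p y k x \<and> lip_lo L C p y k x \<le> lip_hi L C p y k x \<and> lip_hi L C p y k x \<le> C) \<and>
   (\<forall>x x'. lip_lo L C p y k x \<le> lip_lo L C p y k x' + L * dist x x' \<and>
           lip_hi L C p y k x \<le> lip_hi L C p y k x' + L * dist x x')"
proof (induction k)
  case 0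
  then show ?case using C L by auto
next
  case (Suc k)
  define l where "l = lip_lo L C p y k"
  define h where "h = lip_hi L C p y k"
  define z where "z = max (l (p k)) (min (y k) (h (p k)))"
  have step: "lip_lo L C p y (Suc k) x = max (l x) (z - L * dist x (p k))"
       "lip_hi L C p y (Suc k) x = min (h x) (z + L * dist x (p k))" for x
    by (simp_all add: Let_def l_def h_def z_def)
  have IH: "0 \<le> l x" "l x \<le> h x" "h x \<le> C" "l x \<le> l x' + L * dist x x'" "h x \<le> h x' + L * dist x x'" for x x'
    using Suc.IH by (simp_all add: l_def h_def)
  have z: "l (p k) \<le> z" "z \<le> h (p k)"
    using IH(2)[of "p k"] by (auto simp: z_def)
  have nn: "0 \<le> L * dist x x'" for x x'
    using L by simp
  have tri: "L * dist x (p k) \<le> L * dist x' (p k) + L * dist x x'" for x x'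
    using mult_left_mono[OF dist_triangle[of x "p k" x'] L] by (simp add: algebra_simps)
  show ?case
    unfolding step
  proof (intro conjI allI)
    fix x x'
    show "0 \<le> max (l x) (z - L * dist x (p k))"
      using IH(1)[of x] by simp
    show "min (h x) (z + L * dist x (p k)) \<le> C"
      using IH(3)[of x] by simp
    show "max (l x) (z - L * dist x (p k)) \<le> min (h x) (z + L * dist x (p k))"
      using IH(2)[of x] IH(4)[of x "p k"] IH(5)[of "p k" x] z nn[of x "p k"]
      by (auto simp: dist_commute)
    show "max (l x) (z - L * dist x (p k)) \<le> max (l x') (z - L * dist x' (p k)) + L * dist x x'"
      using IH(4)[of x x'] tri[of x' x] by (auto simp: dist_commute)
    show "min (h x) (z + L * dist x (p k)) \<le> min (h x') (z + L * dist x' (p k)) + L * dist x x'"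
      using IH(5)[of x x'] tri[of x x'] by (auto simp: dist_commute)
  qed
qed

lemma lip_env_mono:
  assumes "j \<le> k"
  shows "lip_lo L C p y j x \<le> lip_lo L C p y k x" "lip_hi L C p y k x \<le> lip_hi L C p y j x"
  by (rule lift_Suc_mono_le[OF _ assms] lift_Suc_antimono_le[OF _ assms], simp add: Let_def)+

lemma lip_lo_le_hi: "lip_lo L C p y j x \<le> lip_hi L C p y k x"
proof -
  have "lip_lo L C p y j x \<le> lip_lo L C p y (max j k) x"
    by (rule lip_env_mono) simp
  also have "\<dots> \<le> lip_hi L C p y (max j k) x"
    using lip_env_invariant[of y "max j k"] by blast
  also have "\<dots> \<le> lip_hi L C p y k x"
    by (rule lip_env_mono) simp
  finally show ?thesis .
qed

text \<open>Both cones inserted at step \<open>j\<close> have the same apex over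
  \<open>p j\<close>.\<close>

lemma lip_env_gap: "lip_hi L C p y (Suc j) x - lip_lo L C p y (Suc j) x \<le> 2 * (L * dist x (p j))"
  by (auto simp: Let_def)

text \<open>By induction the sample \<open>f (p k)\<close> already lies between the envelopes, so
  the clamp leaves it unchanged, and the two cones with this apex enclose any
  \<open>L\<close>-Lipschitz function.\<close>

lemma lip_env_encloses:
  assumes f: "f \<in> lip_box L C"
  shows "lip_lo L C p (\<lambda>i. f (p i)) k x \<le> f x \<and> f x \<le> lip_hi L C p (\<lambda>i. f (p i)) k x"
proof (induction k arbitrary: x)
  case 0
  then show ?case using f by (auto simp: lip_box_def)
next
  case (Suc k)
  have "\<bar>f x - f (p k)\<bar> \<le> L * dist x (p k)"
    using f by (auto simp: lip_box_def)
  then show ?case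
    using Suc.IH[of x] Suc.IH[of "p k"] by (auto simp: Let_def max_def min_def)
qed

lemma lip_env_tendsto:
  assumes "\<And>i. (\<lambda>m. Y m i) \<longlonglongrightarrow> y i"
  shows "(\<lambda>m. lip_lo L C p (Y m) k x) \<longlonglongrightarrow> lip_lo L C p y k x \<and>
         (\<lambda>m. lip_hi L C p (Y m) k x) \<longlonglongrightarrow> lip_hi L C p y k x"
proof (induction k arbitrary: x)
  case (Suc k)
  have "(\<lambda>m. max (lip_lo L C p (Y m) k (p k)) (min (Y m k) (lip_hi L C p (Y m) k (p k))))
     \<longlonglongrightarrow> max (lip_lo L C p y k (p k)) (min (y k) (lip_hi L C p y k (p k)))"
    using Suc.IH assms by (intro tendsto_max tendsto_min) auto
  then show ?case
    using Suc.IH[of x] by (auto simp: Let_def intro!: tendsto_intros)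
qed auto

lemma lip_ext_bounds:
  "lip_lo L C p y k x \<le> lip_ext L C p y x" "lip_ext L C p y x \<le> lip_hi L C p y k x"
proof -
  show "lip_lo L C p y k x \<le> lip_ext L C p y x"
    unfolding lip_ext_def by (rule cINF_greatest) (auto simp: lip_lo_le_hi)
  show "lip_ext L C p y x \<le> lip_hi L C p y k x"
    unfolding lip_ext_def
    by (rule cINF_lower) (auto intro!: bdd_belowI2[where m="lip_lo L C p y 0 x"] simp: lip_lo_le_hi simp del: lip_env.simps)
qed

lemma lip_ext_in_lip_box: "lip_ext L C p y \<in> lip_box L C"
proof -
  have le: "lip_ext L C p y x \<le> lip_ext L C p y x' + L * dist x x'" for x x'
  proof -
    have "lip_ext L C p y x - L * dist x x' \<le> lip_hi L C p y k x'" for k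
    proof -
      have "lip_hi L C p y k x \<le> lip_hi L C p y k x' + L * dist x x'"
        using lip_env_invariant[of y k] by blast
      with lip_ext_bounds(2)[of y x k] show ?thesis by simp
    qed
    then have "lip_ext L C p y x - L * dist x x' \<le> lip_ext L C p y x'"
      unfolding lip_ext_def[of L C p y x'] by (intro cINF_greatest) auto
    then show ?thesis by simp
  qed
  have "lip_ext L C p y x \<in> {0..C}" for x
    using lip_ext_bounds[where k=0] by auto
  moreover have "\<bar>lip_ext L C p y x - lip_ext L C p y x'\<bar> \<le> L * dist x x'" for x x'
    using le[of x x'] le[of x' x] by (auto simp: dist_commute abs_le_iff)
  ultimately show ?thesis
    by (auto simp: lip_box_def)
qed

context
  assumes dense: "\<And>x e. e > 0 \<Longrightarrow> \<exists>j. dist x (p j) < e"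
begin

text \<open>The index \<open>j\<close> depends on \<open>x\<close> and \<open>e\<close> but not on
  the data \<open>y\<close>. This uniformity makes the extension continuous in \<open>y\<close>, as
  only one finite stage of the envelopes has to converge.\<close>

lemma lip_gap_small:
  assumes "e > 0"
  obtains j where "\<And>y. lip_hi L C p y (Suc j) x - lip_lo L C p y (Suc j) x < e"
proof -
  \<comment> \<open>Dividing by \<open>L + 1\<close> also covers \<open>L = 0\<close>.\<close>
  obtain j where j: "dist x (p j) < e / (2 * (L + 1))"
    using dense[of "e / (2 * (L + 1))" x] assms L by auto
  have "2 * (L * dist x (p j)) \<le> 2 * (L + 1) * dist x (p j)"
    by (simp add: algebra_simps)
  also have "\<dots> < e"
    using j L by (simp add: field_simps)
  finally have "lip_hi L C p y (Suc j) x - lip_lo L C p y (Suc j) x < e" for y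
    using lip_env_gap[of y j x] by (rule le_less_trans[rotated])
  then show ?thesis
    by (rule that)
qed

lemma lip_ext_restrict:
  assumes f: "f \<in> lip_box L C"
  shows "lip_ext L C p (\<lambda>i. f (p i)) = f"
proof
  fix x
  have "\<bar>lip_ext L C p (\<lambda>i. f (p i)) x - f x\<bar> \<le> e" if e: "e > 0" for e
  proof -
    obtain j where "\<And>y. lip_hi L C p y (Suc j) x - lip_lo L C p y (Suc j) x < e"
      using lip_gap_small[OF e] by blast
    from this[of "\<lambda>i. f (p i)"] show ?thesis
      using lip_env_encloses[OF f, where k="Suc j" and x=x] lip_ext_bounds[where y="\<lambda>i. f (p i)" and k="Suc j" and x=x]
      by linarith
  qed
  then have "\<bar>lip_ext L C p (\<lambda>i. f (p i)) x - f x\<bar> \<le> 0"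
    by (rule dense_ge)
  then show "lip_ext L C p (\<lambda>i. f (p i)) x = f x"
    by simp
qed

lemma lip_ext_tendsto:
  assumes "\<And>i. (\<lambda>m. Y m i) \<longlonglongrightarrow> y i"
  shows "(\<lambda>m. lip_ext L C p (Y m) x) \<longlonglongrightarrow> lip_ext L C p y x"
proof (rule tendstoI)
  fix e :: real assume e: "e > 0"
  obtain j where j: "\<And>y. lip_hi L C p y (Suc j) x - lip_lo L C p y (Suc j) x < e / 3"
    using lip_gap_small[of "e / 3"] e by auto
  have "eventually (\<lambda>m. dist (lip_hi L C p (Y m) (Suc j) x) (lip_hi L C p y (Suc j) x) < e / 3) sequentially"
    using lip_env_tendsto[of Y y "Suc j" x, OF assms] e by (intro tendstoD) auto
  then show "eventually (\<lambda>m. dist (lip_ext L C p (Y m) x) (lip_ext L C p y x) < e) sequentially"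
  proof (eventually_elim)
    case (elim m)
    then show ?case
      using j[of "Y m"] j[of y] lip_ext_bounds[where y="Y m" and k="Suc j" and x=x] lip_ext_bounds[where y=y and k="Suc j" and x=x]
      unfolding dist_real_def by linarith
  qed
qed

end

end

text \<open>Sampling on a dense sequence and extending with \<open>lip_ext\<close> makes the
  function set a retract of the cube, and \<open>T\<close> is conjugated to the map \<open>S\<close>
  there. If \<open>S y = y\<close>, then \<open>T\<close> of the extension of \<open>y\<close> has
  samples \<open>y\<close>, and a function in the box is the extension of its samples.\<close>

theorem schauder_lip_box:
  fixes T :: "('a::{metric_space, second_countable_topology} \<Rightarrow> real) \<Rightarrow> 'a \<Rightarrow> real"
  assumes L: "L \<ge> 0" and C: "C > 0"
    and range: "\<And>f. f \<in> lip_box L C \<Longrightarrow> T f \<in> lip_box L C"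
    and cont: "\<And>F f x. (\<And>k. F k \<in> lip_box L C) \<Longrightarrow> f \<in> lip_box L C \<Longrightarrow>
      (\<And>x. (\<lambda>k. F k x) \<longlonglongrightarrow> f x) \<Longrightarrow> (\<lambda>k. T (F k) x) \<longlonglongrightarrow> T f x"
  obtains f where "f \<in> lip_box L C" "T f = f"
proof -
  obtain D :: "'a set" where D: "countable D" "\<And>X. open X \<Longrightarrow> X \<noteq> {} \<Longrightarrow> \<exists>d\<in>D. d \<in> X"
    using countable_dense_setE[where 'a='a] by metis
  have "D \<noteq> {}"
    using D(2)[of UNIV] by auto
  define p where "p = from_nat_into D"
  have dense: "\<exists>j. dist x (p j) < e" if "e > 0" for x e
  proof -
    obtain d where "d \<in> D" "d \<in> ball x e"
      using D(2)[of "ball x e"] \<open>e > 0\<close> by auto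
    then show ?thesis
      using from_nat_into_surj[OF D(1)] by (metis mem_ball p_def)
  qed
  note [simp] = less_imp_le[OF C]
  define S where "S y i = T (lip_ext L C p y) (p i)" for y i
  have ext: "lip_ext L C p y \<in> lip_box L C" for y
    by (rule lip_ext_in_lip_box) (simp_all add: L)
  have "S y i \<in> {0..C}" for y i
    using range[OF ext[of y]] by (simp add: S_def lip_box_def)
  moreover have "(\<lambda>k. S (Y k) i) \<longlonglongrightarrow> S y i" if "\<And>j. (\<lambda>k. Y k j) \<longlonglongrightarrow> y j" for Y y i
    unfolding S_def by (intro cont ext lip_ext_tendsto that dense L) simp_all
  ultimately obtain y where y: "S y = y"
    using hilbert_cube_fixpoint[OF C, of S] by metis
  have "T (lip_ext L C p y) = lip_ext L C p (\<lambda>i. T (lip_ext L C p y) (p i))"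
    by (intro lip_ext_restrict[symmetric] range ext L dense) simp_all
  also have "(\<lambda>i. T (lip_ext L C p y) (p i)) = y"
    using y by (auto simp: S_def fun_eq_iff)
  finally show ?thesis
    using that ext by blast
qed

section \<open>Minimisers of the dual objective\<close>

definition minimizer :: "real \<Rightarrow> ('w \<Rightarrow> real \<Rightarrow> real) \<Rightarrow> 'w \<times> real \<Rightarrow> real \<Rightarrow> bool" where
  "minimizer T g \<theta> t \<longleftrightarrow> t \<in> {0..T} \<and> (\<forall>s\<in>{0..T}. g (fst \<theta>) t + t * snd \<theta> \<le> g (fst \<theta>) s + s * snd \<theta>)"

text \<open>All selections agree off \<open>ambiguous\<close>. The least one is convenient because
  its sublevel sets are projections of a closed set, which gives measurability.\<close>

definition least_minimizer :: "real \<Rightarrow> ('w \<Rightarrow> real \<Rightarrow> real) \<Rightarrow> 'w \<times> real \<Rightarrow> real" where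
  "least_minimizer T g \<theta> = Inf {t. minimizer T g \<theta> t}"

definition ambiguous :: "real \<Rightarrow> ('w \<Rightarrow> real \<Rightarrow> real) \<Rightarrow> ('w \<times> real) set" where
  "ambiguous T g = {\<theta>. \<exists>s t. s < t \<and> minimizer T g \<theta> s \<and> minimizer T g \<theta> t}"

text \<open>Adding the two optimality inequalities cancels \<open>g\<close>, whose shape is
  therefore irrelevant.\<close>

lemma minimizer_antimono:
  assumes "minimizer T g (w, B) s" "minimizer T g (w, B') s'" "B < B'"
  shows "s' \<le> s"
proof -
  have "g w s + s * B \<le> g w s' + s' * B" "g w s' + s' * B' \<le> g w s + s * B'"
    using assms by (auto simp: minimizer_def)
  then have "(B' - B) * (s' - s) \<le> 0"
    by (simp add: algebra_simps)
  then show ?thesis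
    using \<open>B < B'\<close> by (simp add: mult_le_0_iff)
qed

text \<open>By antitonicity the open intervals between two minimisers at different budgets are
  disjoint, so choosing a rational in each is injective.\<close>

lemma countable_ambiguous_section: "countable {B. (w, B) \<in> ambiguous T g}"
proof -
  have "\<exists>c\<in>\<rat>. \<exists>s t. s < c \<and> c < t \<and> minimizer T g (w, B) s \<and> minimizer T g (w, B) t"
    if "(w, B) \<in> ambiguous T g" for B
    using that Rats_dense_in_real unfolding ambiguous_def by blast
  then obtain c where c: "\<And>B. (w, B) \<in> ambiguous T g \<Longrightarrow> c B \<in> \<rat>"
    "\<And>B. (w, B) \<in> ambiguous T g \<Longrightarrow>
       \<exists>s t. s < c B \<and> c B < t \<and> minimizer T g (w, B) s \<and> minimizer T g (w, B) t"
    by metis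
  have ne: "c B \<noteq> c B'" if B: "(w, B) \<in> ambiguous T g" "(w, B') \<in> ambiguous T g" "B < B'" for B B'
  proof -
    obtain s where s: "s < c B" "minimizer T g (w, B) s"
      using c(2)[OF B(1)] by blast
    obtain t where t: "c B' < t" "minimizer T g (w, B') t"
      using c(2)[OF B(2)] by blast
    have "t \<le> s"
      by (rule minimizer_antimono[OF s(2) t(2) B(3)])
    with s t show ?thesis by simp
  qed
  have "inj_on c {B. (w, B) \<in> ambiguous T g}"
    using ne by (intro linorder_inj_onI) auto
  moreover have "countable (c ` {B. (w, B) \<in> ambiguous T g})"
    using c(1) by (intro countable_subset[OF _ countable_rat]) auto
  ultimately show ?thesis
    by (rule countable_image_inj_on[rotated])
qed

context
  fixes T :: real and g :: "'w::euclidean_space \<Rightarrow> real \<Rightarrow> real"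
  assumes T: "T \<ge> 0" and cont: "continuous_on ({0..T} \<times> UNIV) (\<lambda>(t, w). g w t)"
begin

lemma closed_minimizer_set: "closed {z. minimizer T g (snd z) (fst z)}"
proof -
  have c: "continuous_on ({0..T} \<times> UNIV) (\<lambda>z::real \<times> 'w \<times> real. g (fst (snd z)) (fst z))"
  proof -
    have "continuous_on ({0..T} \<times> UNIV) (\<lambda>z::real \<times> 'w \<times> real. (\<lambda>(t, w). g w t) (fst z, fst (snd z)))"
      by (rule continuous_on_compose2[OF cont]) (auto intro!: continuous_intros)
    then show ?thesis by simp
  qed
  have c': "continuous_on ({0..T} \<times> UNIV) (\<lambda>z::real \<times> 'w \<times> real. g (fst (snd z)) s)" if "s \<in> {0..T}" for s
  proof -
    have "continuous_on ({0..T} \<times> UNIV) (\<lambda>z::real \<times> 'w \<times> real. (\<lambda>(t, w). g w t) (s, fst (snd z)))"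
      by (rule continuous_on_compose2[OF cont]) (use that in \<open>auto intro!: continuous_intros\<close>)
    then show ?thesis by simp
  qed
  have "{z. minimizer T g (snd z) (fst z)} = {0..T} \<times> UNIV \<inter> (\<Inter>s\<in>{0..T}. {z \<in> {0..T} \<times> UNIV.
      g (fst (snd z)) (fst z) + fst z * snd (snd z) \<le> g (fst (snd z)) s + s * snd (snd z)})"
    by (auto simp: minimizer_def)
  moreover have "closed {z \<in> {0..T} \<times> (UNIV :: ('w \<times> real) set).
      g (fst (snd z)) (fst z) + fst z * snd (snd z) \<le> g (fst (snd z)) s + s * snd (snd z)}"
    if "s \<in> {0..T}" for s
    using c c'[OF that] by (intro continuous_on_closed_Collect_le) (auto intro!: continuous_intros closed_Times)
  then have "closed (\<Inter>s\<in>{0..T}. {z \<in> {0..T} \<times> (UNIV :: ('w \<times> real) set).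
      g (fst (snd z)) (fst z) + fst z * snd (snd z) \<le> g (fst (snd z)) s + s * snd (snd z)})"
    by (intro closed_INT) simp
  ultimately show ?thesis
    by (simp add: closed_Int closed_Times)
qed

text \<open>Projecting a closed set along a compact factor keeps it closed. The sublevel sets of the
  least minimiser and the ambiguous set are both built from these sets.\<close>

lemma closed_minimizer_within: "closed {\<theta>. \<exists>t\<in>{a..b}. minimizer T g \<theta> t}"
  using closed_compact_projection[OF compact_Icc[of a b] closed_minimizer_set] by (simp add: Bex_def)

lemma closed_minimizers: "closed {t. minimizer T g \<theta> t}"
proof -
  have "{t. minimizer T g \<theta> t} = (\<lambda>t. (t, \<theta>)) -` {z. minimizer T g (snd z) (fst z)}"
    by auto
  also have "closed \<dots>"
    by (intro continuous_closed_vimage closed_minimizer_set continuous_intros)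
  finally show ?thesis .
qed

lemma minimizer_exists: "\<exists>t. minimizer T g \<theta> t"
proof -
  have "continuous_on {0..T} (\<lambda>t. (\<lambda>(t, w). g w t) (t, fst \<theta>))"
    by (rule continuous_on_compose2[OF cont]) (auto intro!: continuous_intros)
  then have "continuous_on {0..T} (\<lambda>t. g (fst \<theta>) t + t * snd \<theta>)"
    by (auto intro!: continuous_intros)
  then show ?thesis
    using continuous_attains_inf[of "{0..T}"] T unfolding minimizer_def by fastforce
qed

lemma bdd_below_minimizers: "bdd_below {t. minimizer T g \<theta> t}"
  by (rule bdd_belowI[of _ 0]) (auto simp: minimizer_def)

lemma minimizer_least: "minimizer T g \<theta> (least_minimizer T g \<theta>)"
  using closed_contains_Inf[OF _ bdd_below_minimizers closed_minimizers] minimizer_exists[of \<theta>]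
  by (auto simp: least_minimizer_def)

lemma least_minimizer_le: "minimizer T g \<theta> t \<Longrightarrow> least_minimizer T g \<theta> \<le> t"
  unfolding least_minimizer_def by (rule cInf_lower) (auto simp: bdd_below_minimizers)

lemma least_minimizer_range: "least_minimizer T g \<theta> \<in> {0..T}"
  using minimizer_least[of \<theta>] by (simp add: minimizer_def)

lemma borel_measurable_least_minimizer [measurable]: "least_minimizer T g \<in> borel_measurable borel"
proof (rule borel_measurableI_le)
  fix c
  have "{\<theta> \<in> space borel. least_minimizer T g \<theta> \<le> c} = {\<theta>. \<exists>t\<in>{0..c}. minimizer T g \<theta> t}"
  proof (intro Collect_cong iffI; clarsimp simp del: split_paired_All)
    fix w B assume "least_minimizer T g (w, B) \<le> c"
    then show "\<exists>t\<in>{0..c}. minimizer T g (w, B) t"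
      using minimizer_least[of "(w, B)"] least_minimizer_range[of "(w, B)"] by (intro bexI) auto
  next
    fix w B t assume "minimizer T g (w, B) t" "t \<le> c"
    then show "least_minimizer T g (w, B) \<le> c"
      using least_minimizer_le[of "(w, B)" t] by simp
  qed
  then show "{\<theta> \<in> space borel. least_minimizer T g \<theta> \<le> c} \<in> sets borel"
    by (simp add: closed_minimizer_within borel_closed)
qed

text \<open>Separating two minimisers by rationals \<open>p < q\<close> exhibits a countable union
  of closed sets, hence a Borel set; Fubini over the budget coordinate then meets countable sections
  only.\<close>

lemma ambiguous_null_sets: "ambiguous T g \<in> null_sets lborel"
proof -
  have eq: "ambiguous T g = (\<Union>p\<in>\<rat>. \<Union>q\<in>\<rat>. if p < q then
     {\<theta>. \<exists>t\<in>{0..p}. minimizer T g \<theta> t} \<inter> {\<theta>. \<exists>t\<in>{q..T}. minimizer T g \<theta> t} else {})" (is "_ = ?R")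
  proof (intro equalityI subsetI)
    fix \<theta> assume "\<theta> \<in> ambiguous T g"
    then obtain s t where st: "s < t" "minimizer T g \<theta> s" "minimizer T g \<theta> t"
      by (auto simp: ambiguous_def)
    obtain p where p: "p \<in> \<rat>" "s < p" "p < t"
      using Rats_dense_in_real[OF st(1)] by blast
    obtain q where q: "q \<in> \<rat>" "p < q" "q < t"
      using Rats_dense_in_real[OF p(3)] by blast
    have "s \<in> {0..p}" "t \<in> {q..T}"
      using st p q by (auto simp: minimizer_def)
    with st have "\<theta> \<in> {\<theta>. \<exists>t\<in>{0..p}. minimizer T g \<theta> t} \<inter> {\<theta>. \<exists>t\<in>{q..T}. minimizer T g \<theta> t}"
      by blast
    then show "\<theta> \<in> ?R"
      by (intro UN_I[OF p(1)] UN_I[OF q(1)]) (simp only: if_P[OF q(2)])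
  next
    fix \<theta> assume "\<theta> \<in> ?R"
    then obtain p q :: real where "\<theta> \<in> (if p < q then
        {\<theta>. \<exists>t\<in>{0..p}. minimizer T g \<theta> t} \<inter> {\<theta>. \<exists>t\<in>{q..T}. minimizer T g \<theta> t} else {})"
      by blast
    then obtain s t where "p < q" "s \<in> {0..p}" "t \<in> {q..T}" "minimizer T g \<theta> s" "minimizer T g \<theta> t"
      by (cases "p < q") auto
    moreover from this have "s < t"
      by simp
    ultimately show "\<theta> \<in> ambiguous T g"
      unfolding ambiguous_def by blast
  qed
  have m: "(if p < q then {\<theta>. \<exists>t\<in>{0..p}. minimizer T g \<theta> t} \<inter> {\<theta>. \<exists>t\<in>{q..T}. minimizer T g \<theta> t} else {})
      \<in> sets borel" for p q :: real
    by (simp add: borel_closed closed_Int closed_minimizer_within)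
  have meas: "ambiguous T g \<in> sets borel"
    unfolding eq by (intro sets.countable_UN'' countable_rat m)
  have "emeasure lborel (ambiguous T g) = emeasure (lborel \<Otimes>\<^sub>M lborel) (ambiguous T g)"
    by (simp add: lborel_prod)
  also have "\<dots> = (\<integral>\<^sup>+ w. emeasure lborel (Pair w -` ambiguous T g) \<partial>lborel)"
    using meas by (intro lborel.emeasure_pair_measure_alt) (subst lborel_prod, simp)
  also have "\<dots> = 0"
    using countable_ambiguous_section[of _ T g] by (simp add: emeasure_lborel_countable vimage_def)
  finally show ?thesis
    using meas by auto
qed

text \<open>In a compact interval it is enough to identify limit points. Each of them minimises the
  limit objective, and off \<open>ambiguous\<close> there is only one such point, so the selection
  made for each \<open>k\<close> is arbitrary.\<close>

lemma least_minimizer_tendsto: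
  assumes g': "\<And>t. t \<in> {0..T} \<Longrightarrow> (\<lambda>k. G k w t) \<longlonglongrightarrow> g w t"
    and equi: "\<And>k t t'. t \<in> {0..T} \<Longrightarrow> t' \<in> {0..T} \<Longrightarrow> \<bar>G k w t - G k w t'\<bar> \<le> M * \<bar>t - t'\<bar>"
    and min: "\<And>k. minimizer T (G k) (w, B) (m k)"
    and unamb: "(w, B) \<notin> ambiguous T g"
  shows "m \<longlonglongrightarrow> least_minimizer T g (w, B)"
proof (rule ccontr)
  let ?t = "least_minimizer T g (w, B)"
  assume "\<not> m \<longlonglongrightarrow> ?t"
  then obtain e where e: "e > 0" "\<not> eventually (\<lambda>k. dist (m k) ?t < e) sequentially"
    by (auto simp: tendsto_iff)
  then obtain \<phi> where \<phi>: "strict_mono (\<phi> :: nat \<Rightarrow> nat)" "\<And>k. \<not> dist (m (\<phi> k)) ?t < e"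
    using not_eventually_sequentiallyD[OF e(2)] by (auto simp del: not_less)
  have m: "m k \<in> {0..T}" for k
    using min by (auto simp: minimizer_def)
  obtain t \<psi> where t: "t \<in> {0..T}" and \<psi>: "strict_mono (\<psi> :: nat \<Rightarrow> nat)" and lim: "((m \<circ> \<phi>) \<circ> \<psi>) \<longlonglongrightarrow> t"
    by (rule seq_compactE[of "{0..T}" "m \<circ> \<phi>"])
       (use m compact_Icc[of 0 T] in \<open>auto simp: compact_eq_seq_compact_metric\<close>)
  define \<rho> where "\<rho> = \<phi> \<circ> \<psi>"
  have \<rho>: "strict_mono \<rho>"
    unfolding \<rho>_def using \<phi> \<psi> by (simp add: strict_mono_o)
  have lim: "(\<lambda>k. m (\<rho> k)) \<longlonglongrightarrow> t"
    using lim by (simp add: \<rho>_def o_def)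
  have G: "(\<lambda>k. G (\<rho> k) w s) \<longlonglongrightarrow> g w s" if "s \<in> {0..T}" for s
    using LIMSEQ_subseq_LIMSEQ[OF g'[OF that] \<rho>] by (simp add: o_def)
  have "(\<lambda>k. M * \<bar>m (\<rho> k) - t\<bar>) \<longlonglongrightarrow> M * \<bar>t - t\<bar>"
    by (intro tendsto_intros lim)
  then have "(\<lambda>k. M * \<bar>m (\<rho> k) - t\<bar>) \<longlonglongrightarrow> 0"
    by simp
  \<comment> \<open>The common Lipschitz constant replaces the moving argument by \<open>t\<close>,
    so pointwise convergence of \<open>G\<close> is enough.\<close>
  then have "(\<lambda>k. G (\<rho> k) w (m (\<rho> k)) - G (\<rho> k) w t) \<longlonglongrightarrow> 0"
    by (rule Lim_null_comparison[OF always_eventually, rotated]) (use equi m t in simp)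
  from tendsto_add[OF this G[OF t]] have lim_q: "(\<lambda>k. G (\<rho> k) w (m (\<rho> k)) + m (\<rho> k) * B) \<longlonglongrightarrow> g w t + t * B"
    using lim by (auto intro!: tendsto_intros)
  have "g w t + t * B \<le> g w s + s * B" if s: "s \<in> {0..T}" for s
  proof (rule LIMSEQ_le[OF lim_q])
    show "(\<lambda>k. G (\<rho> k) w s + s * B) \<longlonglongrightarrow> g w s + s * B"
      by (intro tendsto_intros G s)
    show "\<exists>N. \<forall>k\<ge>N. G (\<rho> k) w (m (\<rho> k)) + m (\<rho> k) * B \<le> G (\<rho> k) w s + s * B"
      using min s by (auto simp: minimizer_def)
  qed
  then have "minimizer T g (w, B) t"
    using t by (simp add: minimizer_def)
  moreover have "\<not> ?t < t" if "minimizer T g (w, B) t"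
    using unamb that minimizer_least[of "(w, B)"] unfolding ambiguous_def by blast
  ultimately have "t = ?t"
    using least_minimizer_le[of "(w, B)" t] by simp
  moreover obtain k where "dist (m (\<rho> k)) t < e"
    using tendstoD[OF lim e(1)] by (auto simp: eventually_sequentially)
  ultimately show False
    using \<phi>(2)[of "\<psi> k"] by (simp add: \<rho>_def)
qed

end

section \<open>First-price bidding against a fixed distribution\<close>

lemma tendsto_power_le_limit:
  fixes f :: "real \<Rightarrow> real"
  assumes "(f \<longlongrightarrow> a) F" "F \<noteq> bot" "eventually (\<lambda>x. f x ^ m \<le> K) F"
  shows "a ^ m \<le> K"
  using assms by (intro tendsto_upperbound[OF tendsto_power[OF assms(1)]]) auto

context real_distribution
begin

definition top_cdf :: "nat \<Rightarrow> real \<Rightarrow> real" where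
  "top_cdf m x = cdf M x ^ m"

text \<open>Envelope formula: the rent of a bidder with value \<open>x\<close> is the winning
  probability integrated from the reserve price upwards.\<close>

definition surplus :: "nat \<Rightarrow> real \<Rightarrow> real \<Rightarrow> real" where
  "surplus m r x = (LINT s:{r..x}|lborel. top_cdf m s)"

definition fp_bid :: "nat \<Rightarrow> real \<Rightarrow> real \<Rightarrow> real" where
  "fp_bid m r x = (if x < r then x else if top_cdf m x > 0 then x - surplus m r x / top_cdf m x else r)"

text \<open>Law of a single rival's bid. As ties are won, its \<open>m\<close>-th power is the
  probability of beating \<open>m\<close> independent rivals.\<close>

definition bid_cdf :: "nat \<Rightarrow> real \<Rightarrow> real \<Rightarrow> real" where
  "bid_cdf m r b = measure M {x. fp_bid m r x \<le> b}"

lemma top_cdf_mono: "x \<le> y \<Longrightarrow> top_cdf m x \<le> top_cdf m y"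
  unfolding top_cdf_def by (intro power_mono cdf_nondecreasing cdf_nonneg)

lemma top_cdf_nonneg: "0 \<le> top_cdf m x"
  unfolding top_cdf_def by (simp add: cdf_nonneg)

lemma top_cdf_le_1: "top_cdf m x \<le> 1"
  unfolding top_cdf_def by (intro power_le_one cdf_nonneg cdf_bounded_prob)

lemma borel_measurable_top_cdf [measurable]: "top_cdf m \<in> borel_measurable borel"
  by (intro borel_measurable_mono monoI top_cdf_mono)

lemma set_integrable_top_cdf: "set_integrable lborel {a..b} (top_cdf m)"
  unfolding set_integrable_def
  by (rule Bochner_Integration.integrable_bound[where f="indicator {a..b} :: real \<Rightarrow> real"])
     (auto simp: indicator_def top_cdf_nonneg top_cdf_le_1 emeasure_lborel_Icc_eq intro!: AE_I2 integrable_real_indicator)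

lemma surplus_split:
  assumes "r \<le> x" "x \<le> y"
  shows "surplus m r y = surplus m r x + (LINT s:{x..y}|lborel. top_cdf m s)"
proof -
  have "surplus m r y = (LINT s:{r..x} \<union> {x..y}|lborel. top_cdf m s)"
    using assms by (simp add: surplus_def ivl_disj_un_two_touch)
  also have "\<dots> = surplus m r x + (LINT s:{x..y}|lborel. top_cdf m s)"
    unfolding surplus_def
    by (intro set_integral_Un_AE set_integrable_top_cdf) (use AE_lborel_singleton[of x] in \<open>auto\<close>)
  finally show ?thesis .
qed

lemma set_integral_top_cdf_bounds:
  assumes "x \<le> y"
  shows "(y - x) * top_cdf m x \<le> (LINT s:{x..y}|lborel. top_cdf m s)"
    and "(LINT s:{x..y}|lborel. top_cdf m s) \<le> (y - x) * top_cdf m y"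
proof -
  have const: "(LINT s:{x..y}|lborel. c) = (y - x) * c" for c :: real
    using assms by (simp add: set_integral_const)
  have int: "set_integrable lborel {x..y} (\<lambda>s. c)" for c :: real
    by (intro borel_integrable_atLeastAtMost') simp
  have "(LINT s:{x..y}|lborel. top_cdf m x) \<le> (LINT s:{x..y}|lborel. top_cdf m s)"
    by (intro set_integral_mono set_integrable_top_cdf int) (auto intro: top_cdf_mono)
  then show "(y - x) * top_cdf m x \<le> (LINT s:{x..y}|lborel. top_cdf m s)"
    by (simp add: const)
  have "(LINT s:{x..y}|lborel. top_cdf m s) \<le> (LINT s:{x..y}|lborel. top_cdf m y)"
    by (intro set_integral_mono set_integrable_top_cdf int) (auto intro: top_cdf_mono)
  then show "(LINT s:{x..y}|lborel. top_cdf m s) \<le> (y - x) * top_cdf m y"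
    by (simp add: const)
qed

lemma surplus_self [simp]: "x \<le> r \<Longrightarrow> surplus m r x = 0"
  using set_integral_top_cdf_bounds[of x x m]
  by (cases "x = r") (auto simp: surplus_def set_lebesgue_integral_def)

lemma surplus_mono_le:
  assumes "x \<le> y"
  shows "surplus m r x \<le> surplus m r y" "surplus m r y \<le> surplus m r x + (y - x)"
proof -
  have le: "surplus m r x \<le> surplus m r y \<and> surplus m r y \<le> surplus m r x + (y - x)"
    if "r \<le> x" "x \<le> y" for x y
  proof -
    have "0 \<le> (y - x) * top_cdf m x" "(y - x) * top_cdf m y \<le> y - x"
      using that top_cdf_nonneg[of m x] top_cdf_le_1[of m y] by (auto intro: mult_left_le)
    with set_integral_top_cdf_bounds[OF that(2), of m] surplus_split[OF that, of m] show ?thesis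
      by simp
  qed
  show "surplus m r x \<le> surplus m r y" "surplus m r y \<le> surplus m r x + (y - x)"
    using le[of x y] le[of r y] assms by (cases "r \<le> x"; cases "r \<le> y"; force)+
qed

lemma surplus_nonneg: "0 \<le> surplus m r x"
  using surplus_mono_le(1)[of "min r x" x m r] by simp

lemma surplus_le: "surplus m r x \<le> max 0 (x - r)"
  using surplus_mono_le(2)[of "min r x" x m r] by (cases "r \<le> x") auto

lemma surplus_lipschitz: "\<bar>surplus m r x - surplus m r y\<bar> \<le> \<bar>x - y\<bar>"
  using surplus_mono_le[of x y m r] surplus_mono_le[of y x m r] by linarith

\<comment> \<open>The surplus is convex with subgradient \<open>top_cdf\<close>.\<close>
lemma surplus_subgradient:
  assumes "r \<le> x" "r \<le> y"
  shows "(x - y) * top_cdf m y + surplus m r y \<le> surplus m r x"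
proof (cases "x \<le> y")
  case True
  with set_integral_top_cdf_bounds(2)[OF True, of m] surplus_split[OF assms(1) True, of m]
  show ?thesis by (simp add: algebra_simps)
next
  case False
  then have le: "y \<le> x" by simp
  with set_integral_top_cdf_bounds(1)[OF le, of m] surplus_split[OF assms(2) le, of m]
  show ?thesis by (simp add: algebra_simps)
qed

text \<open>If \<open>top_cdf m x = 0\<close>, the surplus at \<open>x\<close> vanishes by
  monotonicity of the integrand, so the default bid \<open>r\<close> satisfies the identity as
  well.\<close>

lemma fp_bid_surplus:
  assumes "r \<le> x"
  shows "(x - fp_bid m r x) * top_cdf m x = surplus m r x"
proof (cases "top_cdf m x > 0")
  case False
  then have "top_cdf m x = 0"
    using top_cdf_nonneg[of m x] by simp
  moreover have "surplus m r x \<le> (x - r) * top_cdf m x"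
    using surplus_subgradient[OF order_refl assms, of m] by (simp add: algebra_simps)
  ultimately show ?thesis
    using surplus_nonneg[of m r x] by simp
qed (use assms in \<open>simp add: fp_bid_def\<close>)

lemma fp_bid_bounds:
  assumes "r \<le> x"
  shows "r \<le> fp_bid m r x" "fp_bid m r x \<le> x"
proof -
  have "surplus m r x \<le> (x - r) * top_cdf m x"
    using surplus_subgradient[OF order_refl assms, of m] by (simp add: algebra_simps)
  then show "r \<le> fp_bid m r x"
    using assms by (simp add: fp_bid_def field_simps)
  show "fp_bid m r x \<le> x"
    using assms surplus_nonneg[of m r x] top_cdf_nonneg[of m x] by (simp add: fp_bid_def)
qed

text \<open>Posing as \<open>y\<close> does not help a bidder with value \<open>x\<close>. Writing
  \<open>H\<close>, \<open>S\<close>, \<open>b\<close> for winning probability, surplus and bid,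
  \<open>(x - y) * H y + S y \<le> S x = (x - b x) * H x \<le> (x - b x) * H y\<close>, and the
  factor \<open>H y\<close> cancels when it is positive. If \<open>H x = 0\<close>, the bid of
  \<open>x\<close> is the reserve price.\<close>

lemma fp_bid_mono:
  assumes "x \<le> y"
  shows "fp_bid m r x \<le> fp_bid m r y"
proof (cases "r \<le> x")
  case True
  with assms have ry: "r \<le> y" by simp
  consider "top_cdf m x = 0" | "top_cdf m x > 0"
    using top_cdf_nonneg[of m x] by linarith
  then show ?thesis
  proof cases
    case 1
    then have "fp_bid m r x = r"
      using True by (simp add: fp_bid_def)
    then show ?thesis
      using fp_bid_bounds(1)[OF ry] by simp
  next
    case 2
    with top_cdf_mono[OF assms, of m] have pos: "top_cdf m y > 0"
      by simp
    have "(x - fp_bid m r x) * top_cdf m x \<le> (x - fp_bid m r x) * top_cdf m y"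
      using top_cdf_mono[OF assms, of m] fp_bid_bounds(2)[OF True, of m] by (intro mult_left_mono) auto
    moreover have "(x - y) * top_cdf m y + surplus m r y \<le> surplus m r x"
      by (rule surplus_subgradient[OF True ry])
    ultimately have "fp_bid m r x * top_cdf m y \<le> fp_bid m r y * top_cdf m y"
      using fp_bid_surplus[OF True, of m] fp_bid_surplus[OF ry, of m] by (simp add: algebra_simps)
    with pos show ?thesis by simp
  qed
next
  case False
  then show ?thesis
    using assms fp_bid_bounds(1)[of r y m] by (cases "r \<le> y") (auto simp: fp_bid_def)
qed

lemma borel_measurable_fp_bid [measurable]: "fp_bid m r \<in> borel_measurable borel"
  by (intro borel_measurable_mono monoI fp_bid_mono)

lemma bid_cdf_nonneg: "0 \<le> bid_cdf m r b"
  by (simp add: bid_cdf_def)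

text \<open>The values that bid at most \<open>b\<close> form a down-set \<open>D\<close>. For
  \<open>y\<close> in \<open>D\<close> with \<open>r \<le> y\<close>, replacing the bid of
  \<open>y\<close> by \<open>b\<close> only lowers the margin, so the subgradient inequality bounds
  \<open>(x - b) * top_cdf m y\<close> by the surplus at \<open>x\<close>. Exhausting
  \<open>D\<close> also covers bids \<open>b\<close> in gaps of the range of
  \<open>fp_bid\<close>.\<close>

lemma fp_bid_best_response:
  assumes "r \<le> b"
  shows "(x - b) * bid_cdf m r b ^ m \<le> surplus m r x"
proof (cases "b < x")
  case False
  then have "(x - b) * bid_cdf m r b ^ m \<le> 0"
    by (intro mult_nonpos_nonneg) (auto simp: bid_cdf_nonneg)
  with surplus_nonneg[of m r x] show ?thesis by linarith
next
  case True
  with assms have rx: "r \<le> x" by simp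
  define D where "D = {y. fp_bid m r y \<le> b}"
  define K where "K = surplus m r x / (x - b)"
  have K: "cdf M y ^ m \<le> K" if "y \<in> D" "r \<le> y" for y
  proof -
    have "(x - b) * top_cdf m y \<le> (x - fp_bid m r y) * top_cdf m y"
      using that top_cdf_nonneg by (intro mult_right_mono) (auto simp: D_def)
    also have "\<dots> = (x - y) * top_cdf m y + surplus m r y"
      using fp_bid_surplus[OF that(2), of m] by (simp add: algebra_simps)
    also have "\<dots> \<le> surplus m r x"
      by (rule surplus_subgradient[OF rx that(2)])
    finally show ?thesis
      using True by (simp add: K_def top_cdf_def field_simps)
  qed
  have down: "y \<in> D" if "z \<in> D" "y \<le> z" for y z
    using that fp_bid_mono[OF that(2), of m r] by (simp add: D_def)
  have r: "r \<in> D"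
    using assms fp_bid_bounds(2)[of r r m] by (simp add: D_def)
  \<comment> \<open>A nonempty down-set of reals is the line, a closed ray or an open ray. The bound
    \<open>K\<close> passes to its measure by the limit at infinity, by evaluation at
    \<open>s\<close>, or by the left limit at \<open>s\<close>.\<close>
  have "measure M D ^ m \<le> K"
  proof (cases "bdd_above D")
    case False
    then have "D = UNIV"
      using down unfolding bdd_above_def by (metis UNIV_eq_I linear)
    moreover have "(1::real) ^ m \<le> K"
      using K by (intro tendsto_power_le_limit[OF cdf_lim_at_top_prob])
        (auto simp: \<open>D = UNIV\<close> intro!: eventually_at_top_linorderI[of r])
    ultimately show ?thesis
      using prob_space by simp
  next
    case bdd: True
    define s where "s = Sup D"
    have le: "y \<le> s" if "y \<in> D" for y
      unfolding s_def by (rule cSup_upper[OF that bdd])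
    have less: "y \<in> D" if "y < s" for y
    proof -
      have "y < Sup D"
        using that by (simp add: s_def)
      moreover have "D \<noteq> {}"
        using r by auto
      ultimately obtain z where z: "z \<in> D" "y < z"
        by (rule less_cSupE)
      then show ?thesis
        using down[OF z(1)] by simp
    qed
    show ?thesis
    proof (cases "s \<in> D")
      case True
      then have "D = {..s}"
        using le down by auto
      then show ?thesis
        using K[OF True le[OF r]] by (simp add: cdf_def2)
    next
      case False
      then have D: "D = {..<s}"
        using le less by (auto simp: order.order_iff_strict)
      moreover have "r < s"
        using r D by simp
      then have "eventually (\<lambda>y. cdf M y ^ m \<le> K) (at_left s)"
        using K D by (intro eventually_at_leftI[of r]) auto
      then have "measure M {..<s} ^ m \<le> K"
        by (intro tendsto_power_le_limit[OF cdf_at_left]) auto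
      ultimately show ?thesis by simp
    qed
  qed
  then show ?thesis
    using True by (simp add: K_def bid_cdf_def D_def field_simps)
qed

\<comment> \<open>This holds even at atoms, because ties are won and \<open>cdf\<close> is right continuous.\<close>
lemma fp_bid_win_prob:
  assumes "r \<le> x"
  shows "bid_cdf m r (fp_bid m r x) ^ m = top_cdf m x"
proof (rule antisym)
  have "cdf M x \<le> bid_cdf m r (fp_bid m r x)"
    unfolding cdf_def2 bid_cdf_def by (intro finite_measure_mono) (auto intro: fp_bid_mono)
  then show "top_cdf m x \<le> bid_cdf m r (fp_bid m r x) ^ m"
    unfolding top_cdf_def by (intro power_mono cdf_nonneg)
  define b where "b = fp_bid m r x"
  have rb: "r \<le> b" and bx: "b \<le> x"
    using fp_bid_bounds[OF assms, of m] by (auto simp: b_def)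
  show "bid_cdf m r (fp_bid m r x) ^ m \<le> top_cdf m x"
  proof (cases "b = x")
    case False
    then have "b < x" using bx by simp
    moreover have "(x - b) * bid_cdf m r b ^ m \<le> (x - b) * top_cdf m x"
      using fp_bid_best_response[OF rb, of x m] fp_bid_surplus[OF assms, of m] by (simp add: b_def)
    ultimately show ?thesis by (simp add: b_def)
  next
    case True
    then have 0: "surplus m r x = 0"
      using fp_bid_surplus[OF assms, of m] by (simp add: b_def)
    \<comment> \<open>At \<open>x\<close> itself the best-response bound is void because
      \<open>x - b = 0\<close>. The same bid is therefore tested against slightly larger values
      \<open>x'\<close>.\<close>
    have le: "bid_cdf m r b ^ m \<le> top_cdf m x'" if "x < x'" for x'
    proof -
      have "(x' - x) * bid_cdf m r b ^ m \<le> surplus m r x'"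
        using fp_bid_best_response[OF rb, of x' m] True by simp
      also have "\<dots> \<le> (x' - x) * top_cdf m x'"
        using surplus_subgradient[of r x x' m] assms that 0 by (simp add: algebra_simps)
      finally show ?thesis using that by simp
    qed
    have "(top_cdf m \<longlongrightarrow> top_cdf m x) (at_right x)"
      unfolding top_cdf_def using cdf_is_right_cont[of x]
      by (intro tendsto_power) (simp add: continuous_within)
    then have "bid_cdf m r b ^ m \<le> top_cdf m x"
      by (rule tendsto_lowerbound) (auto intro!: eventually_at_rightI[of x "x + 1"] le)
    then show ?thesis by (simp add: b_def)
  qed
qed

section \<open>Expected payment at one item and its continuity\<close>

definition fp_payment :: "nat \<Rightarrow> real \<Rightarrow> real \<Rightarrow> real" where
  "fp_payment m r x = (if x < r then 0 else fp_bid m r x * top_cdf m x)"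

lemma fp_payment_eq: "r \<le> x \<Longrightarrow> fp_payment m r x = x * top_cdf m x - surplus m r x"
  using fp_bid_surplus[of r x m] by (simp add: fp_payment_def algebra_simps)

lemma fp_payment_bounds:
  assumes "0 \<le> r"
  shows "0 \<le> fp_payment m r x" "fp_payment m r x \<le> max 0 x"
proof -
  show "0 \<le> fp_payment m r x"
    using assms fp_bid_bounds(1)[of r x m] top_cdf_nonneg[of m x] by (auto simp: fp_payment_def)
  show "fp_payment m r x \<le> max 0 x"
    using assms fp_bid_bounds[of r x m] top_cdf_nonneg[of m x] top_cdf_le_1[of m x]
      mult_mono[of "fp_bid m r x" x "top_cdf m x" 1]
    by (cases "x < r") (auto simp: fp_payment_def)
qed

lemma continuous_surplus: "isCont (surplus m r) x"
proof -
  have "1-lipschitz_on UNIV (surplus m r)"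
    using surplus_lipschitz by (intro lipschitz_onI) (auto simp: dist_real_def)
  then have "continuous_on UNIV (surplus m r)"
    by (rule lipschitz_on_continuous_on)
  then show ?thesis
    by (simp add: continuous_on_eq_continuous_at)
qed

text \<open>The payment can jump only where the distribution function does, or at the reserve price,
  where the bidder starts to participate.\<close>

lemma fp_payment_tendsto:
  assumes X: "X \<longlonglongrightarrow> x" and "measure M {x} = 0" "x \<noteq> r"
  shows "(\<lambda>k. fp_payment m r (X k)) \<longlonglongrightarrow> fp_payment m r x"
proof (cases "x < r")
  case True
  then have "eventually (\<lambda>k. X k < r) sequentially"
    using X by (rule order_tendstoD(2)[rotated])
  then have "eventually (\<lambda>k. fp_payment m r x = fp_payment m r (X k)) sequentially"
    by eventually_elim (use True in \<open>simp add: fp_payment_def\<close>)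
  then show ?thesis
    by (rule Lim_transform_eventually[rotated]) simp
next
  case False
  with assms have rx: "r < x" by simp
  have "eventually (\<lambda>k. r < X k) sequentially"
    using X rx by (rule order_tendstoD(1))
  then have ev: "eventually (\<lambda>k. X k * cdf M (X k) ^ m - surplus m r (X k) = fp_payment m r (X k)) sequentially"
    by eventually_elim (simp add: fp_payment_eq top_cdf_def)
  have "isCont (cdf M) x"
    using assms by (simp add: isCont_cdf)
  then have "(\<lambda>k. X k * cdf M (X k) ^ m - surplus m r (X k)) \<longlonglongrightarrow> x * cdf M x ^ m - surplus m r x"
    by (intro tendsto_intros X isCont_tendsto_compose[OF _ X] continuous_surplus)
  from Lim_transform_eventually[OF this ev] show ?thesis
    using rx by (simp add: fp_payment_eq top_cdf_def)
qed

end

section \<open>Absence of ties\<close>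

lemma AE_lebesgue_hyperplane:
  fixes a :: "'a::euclidean_space"
  assumes "a \<noteq> 0"
  shows "AE x in lebesgue. a \<bullet> x \<noteq> 0"
proof -
  have "{x. a \<bullet> x = 0} \<in> null_sets lebesgue"
    using negligible_hyperplane[of a 0] assms by (simp add: negligible_iff_null_sets)
  from AE_not_in[OF this] show ?thesis by simp
qed

lemma AE_density_lebesgue:
  assumes "\<exists>f. f \<in> borel_measurable lebesgue \<and> M = density lebesgue f" "AE x in lebesgue. P x"
  shows "AE x in M. P x"
  using assms by (auto simp: AE_density)

section \<open>The auction model and its sigma-algebras\<close>

locale auction =
  fixes n :: nat and U Bmin \<omega> :: real
    and A :: "(real^'d::finite) set"
    and F :: "(real^'d) measure"
    and G :: "((real^'d) \<times> real) measure"
    and r :: "real^'d \<Rightarrow> real"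
  assumes d: "CARD('d) \<ge> 2"
    and U: "U > 0" and Bmin: "Bmin > 0"
    and A_meas: "A \<in> sets lebesgue"
    and A_pos: "\<forall>\<alpha>\<in>A. \<forall>i. 0 < \<alpha> $ i"
    and F_prob: "prob_space F"
    and F_dens: "\<exists>f. f \<in> borel_measurable lebesgue \<and> F = density lebesgue f"
    and F_A: "emeasure F (UNIV - A) = 0"
    and G_prob: "prob_space G"
    and G_dens: "\<exists>g. g \<in> borel_measurable lebesgue \<and> G = density lebesgue g"
    and G_Theta: "emeasure G (UNIV - Theta U Bmin) = 0"
    and \<omega>: "\<omega> > 0" "\<forall>w\<in>Theta_w U. \<forall>\<alpha>\<in>A. w \<bullet> \<alpha> \<le> \<omega>"
    and r_meas: "r \<in> borel_measurable lebesgue"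
    and r_pos: "\<forall>\<alpha>\<in>A. 0 < r \<alpha>"
begin

sublocale F: prob_space F by (rule F_prob)
sublocale G: prob_space G by (rule G_prob)
sublocale FG: pair_sigma_finite F G ..

lemma sets_F [measurable_cong]: "sets F = sets lebesgue"
  using F_dens by auto

lemma sets_G [measurable_cong]: "sets G = sets lebesgue"
  using G_dens by auto

lemma space_F [simp]: "space F = UNIV"
  using sets_eq_imp_space_eq[OF sets_F] by simp

lemma space_G [simp]: "space G = UNIV"
  using sets_eq_imp_space_eq[OF sets_G] by simp

text \<open>\<open>F\<close> lives on the completed sigma-algebra, while continuous functions are
  known to be measurable on \<open>borel\<close>. Composition with this identity map connects the
  two; likewise for \<open>G\<close>.\<close>

lemma measurable_ident_F: "(\<lambda>x. x) \<in> F \<rightarrow>\<^sub>M borel"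
  unfolding measurable_cong_sets[OF sets_F refl] by (rule measurable_completion) simp

lemma measurable_ident_G: "(\<lambda>x. x) \<in> G \<rightarrow>\<^sub>M borel"
  unfolding measurable_cong_sets[OF sets_G refl] by (rule measurable_completion) simp

lemma r_measurable [measurable]: "r \<in> borel_measurable F"
  using r_meas by (simp add: measurable_cong_sets[OF sets_F refl])

lemma fst_G: "fst \<in> G \<rightarrow>\<^sub>M borel"
  by (rule measurable_compose[OF measurable_ident_G])
     (intro borel_measurable_continuous_onI continuous_intros)

lemma AE_F_A: "AE \<alpha> in F. \<alpha> \<in> A"
  using F_A A_meas by (intro AE_I[where N="UNIV - A"]) (auto simp: sets_F)

lemma Theta_eq: "Theta U Bmin = box 0 (\<chi> i. U) \<times> {Bmin<..<U}"
  by (auto simp: Theta_def Theta_w_def mem_box_cart)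

lemma AE_G_Theta: "AE \<theta> in G. \<theta> \<in> Theta U Bmin"
proof -
  have "open (Theta U Bmin :: ((real^'d) \<times> real) set)"
    unfolding Theta_eq by (intro open_Times open_box open_greaterThanLessThan)
  then have "Theta U Bmin \<in> sets G"
    by (simp add: sets_G)
  from sets.compl_sets[OF this] show ?thesis
    using G_Theta by (intro AE_I[where N="UNIV - Theta U Bmin"]) auto
qed

lemma AE_F_hyperplane: "a \<noteq> 0 \<Longrightarrow> AE \<alpha> in F. a \<bullet> \<alpha> \<noteq> 0"
  by (intro AE_density_lebesgue[OF F_dens] AE_lebesgue_hyperplane)

text \<open>Testing the value bound with the weight vector whose entries are all
  \<open>U / 2\<close> bounds the sum of the positive coordinates, hence the norm. This is the
  origin of the Lipschitz constant \<open>2 * \<omega> / U\<close>.\<close>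

lemma A_norm:
  assumes "\<alpha> \<in> A"
  shows "norm \<alpha> \<le> 2 * \<omega> / U"
proof -
  have "(\<chi> i. U / 2) \<in> Theta_w U"
    using U by (simp add: Theta_w_def)
  with \<omega>(2) assms have "(\<chi> i. U / 2) \<bullet> \<alpha> \<le> \<omega>"
    by blast
  then have "U / 2 * (\<Sum>i\<in>UNIV. \<alpha> $ i) \<le> \<omega>"
    by (simp add: inner_vec_def sum_distrib_left)
  moreover have "norm \<alpha> \<le> (\<Sum>i\<in>UNIV. \<alpha> $ i)"
    using norm_le_l1_cart[of \<alpha>] A_pos assms by (simp add: less_imp_le)
  moreover have "U / 2 * norm \<alpha> \<le> U / 2 * (\<Sum>i\<in>UNIV. \<alpha> $ i)"
    using U calculation(2) by simp
  ultimately have "U / 2 * norm \<alpha> \<le> \<omega>"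
    by linarith
  then show ?thesis
    using U by (simp add: field_simps)
qed

text \<open>Nonnegativity on the whole space keeps \<open>1 + \<mu> \<theta>\<close> positive
  without almost-everywhere side conditions.\<close>

definition pacing :: "((real^'d) \<times> real \<Rightarrow> real) \<Rightarrow> bool" where
  "pacing \<mu> \<longleftrightarrow> \<mu> \<in> borel_measurable G \<and> (\<forall>\<theta>. 0 \<le> \<mu> \<theta>)"

lemma pacing_measurable: "pacing \<mu> \<Longrightarrow> \<mu> \<in> borel_measurable G"
  and pacing_nonneg: "pacing \<mu> \<Longrightarrow> 0 \<le> \<mu> \<theta>"
  by (simp_all add: pacing_def del: split_paired_All)

lemma paced_value_joint_measurable:
  assumes "pacing \<mu>" "f \<in> M \<rightarrow>\<^sub>M F" "g \<in> M \<rightarrow>\<^sub>M G"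
  shows "(\<lambda>z. paced_value \<mu> (f z) (g z)) \<in> borel_measurable M"
  unfolding paced_value_def
  by (intro borel_measurable_divide borel_measurable_inner borel_measurable_add borel_measurable_const
      measurable_compose[OF assms(2) measurable_ident_F] measurable_compose[OF assms(3) fst_G]
      measurable_compose[OF assms(3) pacing_measurable[OF assms(1)]])

lemma paced_value_measurable:
  assumes "pacing \<mu>"
  shows "paced_value \<mu> \<alpha> \<in> borel_measurable G"
  using paced_value_joint_measurable[OF assms, of "\<lambda>_. \<alpha>" G "\<lambda>\<theta>. \<theta>"] by simp

lemma real_distribution_paced:
  assumes "pacing \<mu>"
  shows "real_distribution (paced_dist G \<mu> \<alpha>)"
  unfolding paced_dist_def by (intro G.real_distribution_distr paced_value_measurable assms)

lemma measure_paced_dist: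
  assumes "pacing \<mu>" "S \<in> sets borel"
  shows "measure (paced_dist G \<mu> \<alpha>) S = measure G {\<theta>. paced_value \<mu> \<alpha> \<theta> \<in> S}"
  using assms paced_value_measurable[OF assms(1), of \<alpha>]
  by (simp add: paced_dist_def measure_distr vimage_def)

text \<open>Equal paced values mean that \<open>\<alpha>\<close> is orthogonal to the difference of
  the scaled weights \<open>?u\<close>. That difference is nonzero for almost every pair, whatever
  the multipliers, because equal scaled weights come from proportional weight vectors.\<close>

lemma AE_paced_value_ne_pair:
  assumes \<mu>: "pacing \<mu>"
  shows "AE \<alpha> in F. AE p in G \<Otimes>\<^sub>M G. paced_value \<mu> \<alpha> (fst p) \<noteq> paced_value \<mu> \<alpha> (snd p)"
proof -
  interpret GG: pair_prob_space G G ..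
  interpret FGG: pair_sigma_finite F "G \<Otimes>\<^sub>M G" ..
  have [measurable]: "\<mu> \<in> borel_measurable G"
    by (rule pacing_measurable[OF \<mu>])
  let ?u = "\<lambda>\<theta>. fst \<theta> /\<^sub>R (1 + \<mu> \<theta>)"
  obtain i j :: 'd where ij: "i \<noteq> j"
  proof -
    have "\<not> card (UNIV :: 'd set) \<le> Suc 0"
      using d by simp
    then show ?thesis
      using that by (auto simp: card_le_Suc0_iff_eq)
  qed
  have pos: "0 < 1 + \<mu> \<theta>" for \<theta>
    using pacing_nonneg[OF \<mu>, of \<theta>] by simp
  have AE_u: "AE \<theta>' in G. ?u \<theta> \<noteq> ?u \<theta>'" if \<theta>: "\<theta> \<in> Theta U Bmin" for \<theta>
  proof -
    \<comment> \<open>The inner product of \<open>a\<close> with \<theta>' is the 2x2 minor of the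
      two weight vectors in coordinates \<open>i\<close>, \<open>j\<close>. It vanishes for
      proportional weights, and for fixed \<theta> it is a nonzero linear form in \<theta>', so its
      zero set is a hyperplane of types.\<close>
    define a :: "(real^'d) \<times> real" where "a = (axis j (fst \<theta> $ i) - axis i (fst \<theta> $ j), 0)"
    have "fst a $ j = fst \<theta> $ i"
      using ij by (simp add: a_def axis_def)
    moreover have "0 < fst \<theta> $ i"
      using \<theta> by (auto simp: Theta_def Theta_w_def split: prod.splits)
    ultimately have "a \<noteq> 0"
      by auto
    then have "AE \<theta>' in G. a \<bullet> \<theta>' \<noteq> 0"
      by (intro AE_density_lebesgue[OF G_dens] AE_lebesgue_hyperplane)
    then show ?thesis
    proof (rule eventually_mono)
      fix \<theta>' assume ne: "a \<bullet> \<theta>' \<noteq> 0"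
      have inner: "a \<bullet> \<theta>' = fst \<theta> $ i * fst \<theta>' $ j - fst \<theta> $ j * fst \<theta>' $ i"
        by (cases \<theta>') (simp add: a_def inner_diff_left inner_axis')
      show "?u \<theta> \<noteq> ?u \<theta>'"
      proof
        assume "?u \<theta> = ?u \<theta>'"
        then have "?u \<theta> $ k = ?u \<theta>' $ k" for k
          by simp
        then have "fst \<theta> $ k * (1 + \<mu> \<theta>') = fst \<theta>' $ k * (1 + \<mu> \<theta>)" for k
          using pos[of \<theta>] pos[of \<theta>'] by (simp add: field_simps)
        from this[of i] this[of j]
        have "(fst \<theta> $ i * fst \<theta>' $ j) * ((1 + \<mu> \<theta>') * (1 + \<mu> \<theta>)) =
              (fst \<theta> $ j * fst \<theta>' $ i) * ((1 + \<mu> \<theta>') * (1 + \<mu> \<theta>))"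
          by algebra
        then show False
          using ne pos[of \<theta>] pos[of \<theta>'] by (simp add: inner)
      qed
    qed
  qed
  have "AE \<theta> in G. AE \<theta>' in G. ?u \<theta> \<noteq> ?u \<theta>'"
    using AE_G_Theta by (rule eventually_mono) (rule AE_u)
  then have "AE p in G \<Otimes>\<^sub>M G. ?u (fst p) \<noteq> ?u (snd p)"
    by (intro GG.AE_pair_measure) (use fst_G in measurable)
  \<comment> \<open>The hyperplane argument fixes the pair and varies the item; Fubini exchanges the
    two quantifiers at the end.\<close>
  then have "AE p in G \<Otimes>\<^sub>M G. AE \<alpha> in F. paced_value \<mu> \<alpha> (fst p) \<noteq> paced_value \<mu> \<alpha> (snd p)"
  proof (rule eventually_mono)
    fix p assume "?u (fst p) \<noteq> ?u (snd p)"
    then have "AE \<alpha> in F. (?u (fst p) - ?u (snd p)) \<bullet> \<alpha> \<noteq> 0"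
      by (intro AE_F_hyperplane) simp
    then show "AE \<alpha> in F. paced_value \<mu> \<alpha> (fst p) \<noteq> paced_value \<mu> \<alpha> (snd p)"
      by (rule eventually_mono) (simp add: paced_value_def inner_diff_left divide_inverse_commute)
  qed
  moreover have [measurable]: "(\<lambda>z. paced_value \<mu> (fst z) (fst (snd z))) \<in> borel_measurable (F \<Otimes>\<^sub>M (G \<Otimes>\<^sub>M G))"
    "(\<lambda>z. paced_value \<mu> (fst z) (snd (snd z))) \<in> borel_measurable (F \<Otimes>\<^sub>M (G \<Otimes>\<^sub>M G))"
    by (intro paced_value_joint_measurable[OF \<mu>] measurable_fst measurable_compose[OF measurable_snd] measurable_snd)+
  have "{z \<in> space (F \<Otimes>\<^sub>M (G \<Otimes>\<^sub>M G)).
      paced_value \<mu> (fst z) (fst (snd z)) \<noteq> paced_value \<mu> (fst z) (snd (snd z))} \<in> sets (F \<Otimes>\<^sub>M (G \<Otimes>\<^sub>M G))"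
    by measurable
  ultimately show ?thesis
    by (subst FGG.AE_commute) simp_all
qed

text \<open>Quantifying over all \<open>c\<close> inside would need uncountably many null sets if
  each level were treated separately. Instead an atom \<open>E\<close> yields the set
  \<open>E \<times> E\<close> of tied pairs, whose measure is the square of that of
  \<open>E\<close>.\<close>

lemma AE_paced_atomless:
  assumes \<mu>: "pacing \<mu>"
  shows "AE \<alpha> in F. \<forall>c. AE \<theta> in G. paced_value \<mu> \<alpha> \<theta> \<noteq> c"
  using AE_paced_value_ne_pair[OF \<mu>]
proof (rule eventually_mono, intro allI)
  fix \<alpha> c
  assume ae: "AE p in G \<Otimes>\<^sub>M G. paced_value \<mu> \<alpha> (fst p) \<noteq> paced_value \<mu> \<alpha> (snd p)"
  define E where "E = {\<theta>. paced_value \<mu> \<alpha> \<theta> = c}"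
  have E: "E \<in> sets G"
    using measurable_sets[OF paced_value_measurable[OF \<mu>, of \<alpha>], of "{c}"] by (simp add: E_def vimage_def)
  have "AE p in G \<Otimes>\<^sub>M G. p \<notin> E \<times> E"
    using ae by (rule eventually_mono) (auto simp: E_def)
  then have "emeasure (G \<Otimes>\<^sub>M G) (E \<times> E) = 0"
    using E by (subst (asm) AE_iff_measurable[of "E \<times> E"]) (auto simp: space_pair_measure)
  then have "emeasure G E = 0"
    using E by (simp add: G.emeasure_pair_measure_Times)
  then show "AE \<theta> in G. paced_value \<mu> \<alpha> \<theta> \<noteq> c"
    using E by (intro AE_I[where N=E]) (auto simp: E_def)
qed

end

section \<open>The fixed point\<close>

context auction
begin

text \<open>As an integral over \<open>G\<close> the distribution function is accessible to Fubini,
  for measurability in the item, and to dominated convergence in the pacing function.\<close>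

lemma cdf_paced:
  assumes "pacing \<mu>"
  shows "cdf (paced_dist G \<mu> \<alpha>) s = (\<integral>\<theta>. (if paced_value \<mu> \<alpha> \<theta> \<le> s then 1 else 0) \<partial>G)"
proof -
  have "cdf (paced_dist G \<mu> \<alpha>) s = measure G {\<theta>. paced_value \<mu> \<alpha> \<theta> \<le> s}"
    using measure_paced_dist[OF assms, of "{..s}" \<alpha>] by (simp add: cdf_def2)
  also have "\<dots> = (\<integral>\<theta>. indicator {\<theta>. paced_value \<mu> \<alpha> \<theta> \<le> s} \<theta> \<partial>G)"
    by simp
  also have "\<dots> = (\<integral>\<theta>. (if paced_value \<mu> \<alpha> \<theta> \<le> s then 1 else 0) \<partial>G)"
    by (intro Bochner_Integration.integral_cong) (auto simp: indicator_def)
  finally show ?thesis .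
qed

lemma cdf_paced_measurable:
  assumes \<mu>: "pacing \<mu>" and f: "f \<in> M \<rightarrow>\<^sub>M F" and g [measurable]: "g \<in> borel_measurable M"
  shows "(\<lambda>z. cdf (paced_dist G \<mu> (f z)) (g z)) \<in> borel_measurable M"
proof -
  have [measurable]: "(\<lambda>p. paced_value \<mu> (f (fst p)) (snd p)) \<in> borel_measurable (M \<Otimes>\<^sub>M G)"
    by (intro paced_value_joint_measurable[OF \<mu>] measurable_compose[OF measurable_fst f] measurable_snd)
  show ?thesis
    unfolding cdf_paced[OF \<mu>] by (intro G.borel_measurable_lebesgue_integral) measurable
qed

definition buyer_surplus :: "((real^'d) \<times> real \<Rightarrow> real) \<Rightarrow> real^'d \<Rightarrow> real \<Rightarrow> real" where
  "buyer_surplus \<mu> \<alpha> = real_distribution.surplus (paced_dist G \<mu> \<alpha>) (n - 1) (r \<alpha>)"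

lemma buyer_surplus_eq:
  assumes "pacing \<mu>"
  shows "buyer_surplus \<mu> \<alpha> x =
    (\<integral>s. (if r \<alpha> \<le> s \<and> s \<le> x then cdf (paced_dist G \<mu> \<alpha>) s ^ (n - 1) else 0) \<partial>lborel)"
proof -
  interpret real_distribution "paced_dist G \<mu> \<alpha>"
    by (rule real_distribution_paced[OF assms])
  show ?thesis
    unfolding buyer_surplus_def surplus_def set_lebesgue_integral_def top_cdf_def
    by (intro Bochner_Integration.integral_cong) (auto simp: indicator_def)
qed

lemma buyer_surplus_bounds:
  assumes "pacing \<mu>"
  shows "0 \<le> buyer_surplus \<mu> \<alpha> x" "buyer_surplus \<mu> \<alpha> x \<le> max 0 (x - r \<alpha>)"
    "\<bar>buyer_surplus \<mu> \<alpha> x - buyer_surplus \<mu> \<alpha> y\<bar> \<le> \<bar>x - y\<bar>"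
proof -
  interpret real_distribution "paced_dist G \<mu> \<alpha>"
    by (rule real_distribution_paced[OF assms])
  show "0 \<le> buyer_surplus \<mu> \<alpha> x" "buyer_surplus \<mu> \<alpha> x \<le> max 0 (x - r \<alpha>)"
    "\<bar>buyer_surplus \<mu> \<alpha> x - buyer_surplus \<mu> \<alpha> y\<bar> \<le> \<bar>x - y\<bar>"
    unfolding buyer_surplus_def by (rule surplus_nonneg surplus_le surplus_lipschitz)+
qed

lemma buyer_surplus_measurable:
  assumes \<mu>: "pacing \<mu>" and f: "f \<in> M \<rightarrow>\<^sub>M F" and g [measurable]: "g \<in> borel_measurable M"
  shows "(\<lambda>z. buyer_surplus \<mu> (f z) (g z)) \<in> borel_measurable M"
proof -
  have [measurable]: "(\<lambda>p. cdf (paced_dist G \<mu> (f (fst p))) (snd p)) \<in> borel_measurable (M \<Otimes>\<^sub>M lborel)"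
    by (intro cdf_paced_measurable[OF \<mu>] measurable_compose[OF measurable_fst f]) simp
  have [measurable]: "(\<lambda>z. r (f z)) \<in> borel_measurable M"
    by (rule measurable_compose[OF f r_measurable])
  show ?thesis
    unfolding buyer_surplus_eq[OF \<mu>] by (intro lborel.borel_measurable_lebesgue_integral) measurable
qed

section \<open>Continuity in the pacing function\<close>

lemma cdf_paced_tendsto:
  assumes \<mu>k: "\<And>k. pacing (\<mu>k k)" and \<mu>: "pacing \<mu>"
    and lim: "AE \<theta> in G. (\<lambda>k. \<mu>k k \<theta>) \<longlonglongrightarrow> \<mu> \<theta>"
    and ne: "AE \<theta> in G. paced_value \<mu> \<alpha> \<theta> \<noteq> s"
  shows "(\<lambda>k. cdf (paced_dist G (\<mu>k k) \<alpha>) s) \<longlonglongrightarrow> cdf (paced_dist G \<mu> \<alpha>) s"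
  unfolding cdf_paced[OF \<mu>k] cdf_paced[OF \<mu>]
proof (rule integral_dominated_convergence[where w="\<lambda>_. 1"])
  have [measurable]: "paced_value \<mu> \<alpha> \<in> borel_measurable G" "\<And>k. paced_value (\<mu>k k) \<alpha> \<in> borel_measurable G"
    by (intro paced_value_measurable \<mu> \<mu>k)+
  show "(\<lambda>\<theta>. if paced_value \<mu> \<alpha> \<theta> \<le> s then 1 else 0 :: real) \<in> borel_measurable G"
    by measurable
  show "(\<lambda>\<theta>. if paced_value (\<mu>k k) \<alpha> \<theta> \<le> s then 1 else 0 :: real) \<in> borel_measurable G" for k
    by measurable
  show "AE \<theta> in G. (\<lambda>k. if paced_value (\<mu>k k) \<alpha> \<theta> \<le> s then 1 else 0 :: real)
      \<longlonglongrightarrow> (if paced_value \<mu> \<alpha> \<theta> \<le> s then 1 else 0)"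
    using lim ne
  proof eventually_elim
    case (elim \<theta>)
    have "1 + \<mu> \<theta> \<noteq> 0"
      using pacing_nonneg[OF \<mu>, of \<theta>] by simp
    then have X: "(\<lambda>k. paced_value (\<mu>k k) \<alpha> \<theta>) \<longlonglongrightarrow> paced_value \<mu> \<alpha> \<theta>"
      unfolding paced_value_def by (intro tendsto_intros elim)
    show ?case
    proof (cases "paced_value \<mu> \<alpha> \<theta> < s")
      case True
      have "eventually (\<lambda>k. paced_value (\<mu>k k) \<alpha> \<theta> < s) sequentially"
        by (rule order_tendstoD(2)[OF X True])
      then show ?thesis
        by (intro tendsto_eventually, elim eventually_mono) (use True in auto)
    next
      case False
      with elim have "s < paced_value \<mu> \<alpha> \<theta>" by simp
      then have "eventually (\<lambda>k. s < paced_value (\<mu>k k) \<alpha> \<theta>) sequentially"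
        by (rule order_tendstoD(1)[OF X])
      then show ?thesis
        by (intro tendsto_eventually, elim eventually_mono) (use \<open>s < _\<close> in auto)
    qed
  qed
qed auto

lemma buyer_surplus_tendsto:
  assumes \<mu>k: "\<And>k. pacing (\<mu>k k)" and \<mu>: "pacing \<mu>"
    and lim: "AE \<theta> in G. (\<lambda>k. \<mu>k k \<theta>) \<longlonglongrightarrow> \<mu> \<theta>"
    and ne: "\<forall>c. AE \<theta> in G. paced_value \<mu> \<alpha> \<theta> \<noteq> c"
  shows "(\<lambda>k. buyer_surplus (\<mu>k k) \<alpha> x) \<longlonglongrightarrow> buyer_surplus \<mu> \<alpha> x"
  unfolding buyer_surplus_eq[OF \<mu>k] buyer_surplus_eq[OF \<mu>]
proof (rule integral_dominated_convergence[where w="indicator {r \<alpha>..x}"])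
  have meas: "(\<lambda>s. if r \<alpha> \<le> s \<and> s \<le> x then cdf (paced_dist G \<nu> \<alpha>) s ^ (n - 1) else 0) \<in> borel_measurable lborel"
    and bound: "\<bar>cdf (paced_dist G \<nu> \<alpha>) s ^ (n - 1)\<bar> \<le> 1" if "pacing \<nu>" for \<nu> s
  proof -
    interpret real_distribution "paced_dist G \<nu> \<alpha>"
      by (rule real_distribution_paced[OF that])
    show "\<bar>cdf (paced_dist G \<nu> \<alpha>) s ^ (n - 1)\<bar> \<le> 1"
      using top_cdf_nonneg[of "n - 1" s] top_cdf_le_1[of "n - 1" s] by (simp add: top_cdf_def)
    have "(\<lambda>s. if r \<alpha> \<le> s \<and> s \<le> x then top_cdf (n - 1) s else 0) \<in> borel_measurable borel"
      by measurable
    then show "(\<lambda>s. if r \<alpha> \<le> s \<and> s \<le> x then cdf (paced_dist G \<nu> \<alpha>) s ^ (n - 1) else 0) \<in> borel_measurable lborel"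
      unfolding top_cdf_def by simp
  qed
  show "(\<lambda>s. if r \<alpha> \<le> s \<and> s \<le> x then cdf (paced_dist G \<mu> \<alpha>) s ^ (n - 1) else 0) \<in> borel_measurable lborel"
    by (rule meas[OF \<mu>])
  show "(\<lambda>s. if r \<alpha> \<le> s \<and> s \<le> x then cdf (paced_dist G (\<mu>k k) \<alpha>) s ^ (n - 1) else 0) \<in> borel_measurable lborel" for k
    by (rule meas[OF \<mu>k])
  show "integrable lborel (indicator {r \<alpha>..x} :: real \<Rightarrow> real)"
    by (intro integrable_real_indicator) (auto simp: emeasure_lborel_Icc_eq)
  show "AE s in lborel. norm (if r \<alpha> \<le> s \<and> s \<le> x then cdf (paced_dist G (\<mu>k k) \<alpha>) s ^ (n - 1) else 0)
      \<le> indicator {r \<alpha>..x} s" for k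
    using bound[OF \<mu>k] by (auto simp: indicator_def)
  show "AE s in lborel. (\<lambda>k. if r \<alpha> \<le> s \<and> s \<le> x then cdf (paced_dist G (\<mu>k k) \<alpha>) s ^ (n - 1) else 0)
      \<longlonglongrightarrow> (if r \<alpha> \<le> s \<and> s \<le> x then cdf (paced_dist G \<mu> \<alpha>) s ^ (n - 1) else 0)"
    using cdf_paced_tendsto[OF \<mu>k \<mu> lim] ne by (intro AE_I2) (auto intro!: tendsto_power)
qed

text \<open>
  Truncating at \<open>\<omega>\<close> is harmless for paced values and makes the function bounded on the whole space.
\<close>

definition mean_surplus :: "((real^'d) \<times> real \<Rightarrow> real) \<Rightarrow> real^'d \<Rightarrow> real" where
  "mean_surplus \<mu> x = (\<integral>\<alpha>. buyer_surplus \<mu> \<alpha> (min (x \<bullet> \<alpha>) \<omega>) \<partial>F)"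

lemma inner_measurable_F [measurable]: "(\<lambda>\<alpha>. x \<bullet> \<alpha>) \<in> borel_measurable F"
  by (intro borel_measurable_inner measurable_ident_F) simp

lemma mean_surplus_integrand:
  assumes "pacing \<mu>"
  shows "(\<lambda>\<alpha>. buyer_surplus \<mu> \<alpha> (min (x \<bullet> \<alpha>) \<omega>)) \<in> borel_measurable F"
    and "\<alpha> \<in> A \<Longrightarrow> norm (buyer_surplus \<mu> \<alpha> (min (x \<bullet> \<alpha>) \<omega>)) \<le> \<omega>"
proof -
  show "(\<lambda>\<alpha>. buyer_surplus \<mu> \<alpha> (min (x \<bullet> \<alpha>) \<omega>)) \<in> borel_measurable F"
    by (intro buyer_surplus_measurable assms) auto
  show "norm (buyer_surplus \<mu> \<alpha> (min (x \<bullet> \<alpha>) \<omega>)) \<le> \<omega>" if "\<alpha> \<in> A"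
    using buyer_surplus_bounds(1,2)[OF assms, of \<alpha> "min (x \<bullet> \<alpha>) \<omega>"] \<omega>(1) r_pos that by force
qed

lemma mean_surplus_integrable:
  assumes "pacing \<mu>"
  shows "integrable F (\<lambda>\<alpha>. buyer_surplus \<mu> \<alpha> (min (x \<bullet> \<alpha>) \<omega>))"
  by (intro F.integrable_const_bound[where B=\<omega>] mean_surplus_integrand(1)[OF assms]
      eventually_mono[OF AE_F_A mean_surplus_integrand(2)[OF assms]])

text \<open>The surplus and the truncation are 1-Lipschitz in the value, and the value is Lipschitz
  in \<open>x\<close> with constant the norm of the item. Neither constant mentions \<mu>, which
  makes the box invariant.\<close>

lemma mean_surplus_in_lip_box:
  assumes \<mu>: "pacing \<mu>"
  shows "mean_surplus \<mu> \<in> lip_box (2 * \<omega> / U) \<omega>"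
  unfolding lip_box_def
proof (intro CollectI conjI allI)
  fix x y
  have "0 \<le> mean_surplus \<mu> x"
    unfolding mean_surplus_def by (intro Bochner_Integration.integral_nonneg buyer_surplus_bounds \<mu>)
  moreover have "mean_surplus \<mu> x \<le> (\<integral>\<alpha>. \<omega> \<partial>F)"
    unfolding mean_surplus_def
    by (intro integral_mono_AE mean_surplus_integrable \<mu>)
       (auto intro!: eventually_mono[OF AE_F_A] dest: mean_surplus_integrand(2)[OF \<mu>, of _ x])
  ultimately show "mean_surplus \<mu> x \<in> {0..\<omega>}"
    using F.prob_space by simp
  have diff: "integrable F (\<lambda>\<alpha>. buyer_surplus \<mu> \<alpha> (min (x \<bullet> \<alpha>) \<omega>) - buyer_surplus \<mu> \<alpha> (min (y \<bullet> \<alpha>) \<omega>))"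
    by (intro Bochner_Integration.integrable_diff mean_surplus_integrable \<mu>)
  have "\<bar>mean_surplus \<mu> x - mean_surplus \<mu> y\<bar> =
      \<bar>\<integral>\<alpha>. buyer_surplus \<mu> \<alpha> (min (x \<bullet> \<alpha>) \<omega>) - buyer_surplus \<mu> \<alpha> (min (y \<bullet> \<alpha>) \<omega>) \<partial>F\<bar>"
    unfolding mean_surplus_def
    by (subst Bochner_Integration.integral_diff) (auto intro!: mean_surplus_integrable \<mu>)
  also have "\<dots> \<le> (\<integral>\<alpha>. \<bar>buyer_surplus \<mu> \<alpha> (min (x \<bullet> \<alpha>) \<omega>) - buyer_surplus \<mu> \<alpha> (min (y \<bullet> \<alpha>) \<omega>)\<bar> \<partial>F)"
    by (rule integral_abs_bound)
  also have "\<dots> \<le> (\<integral>\<alpha>. 2 * \<omega> / U * dist x y \<partial>F)"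
  proof (intro integral_mono_AE integrable_abs diff F.integrable_const eventually_mono[OF AE_F_A])
    fix \<alpha> assume \<alpha>: "\<alpha> \<in> A"
    have "\<bar>buyer_surplus \<mu> \<alpha> (min (x \<bullet> \<alpha>) \<omega>) - buyer_surplus \<mu> \<alpha> (min (y \<bullet> \<alpha>) \<omega>)\<bar> \<le>
        \<bar>min (x \<bullet> \<alpha>) \<omega> - min (y \<bullet> \<alpha>) \<omega>\<bar>"
      by (rule buyer_surplus_bounds(3)[OF \<mu>])
    also have "\<dots> \<le> \<bar>(x - y) \<bullet> \<alpha>\<bar>"
      by (auto simp: inner_diff_left min_def)
    also have "\<dots> \<le> norm (x - y) * norm \<alpha>"
      by (rule Cauchy_Schwarz_ineq2)
    also have "\<dots> \<le> dist x y * (2 * \<omega> / U)"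
      unfolding dist_norm by (intro mult_left_mono A_norm \<alpha>) simp
    finally show "\<bar>buyer_surplus \<mu> \<alpha> (min (x \<bullet> \<alpha>) \<omega>) - buyer_surplus \<mu> \<alpha> (min (y \<bullet> \<alpha>) \<omega>)\<bar> \<le> 2 * \<omega> / U * dist x y"
      by (simp add: mult.commute)
  qed
  finally show "\<bar>mean_surplus \<mu> x - mean_surplus \<mu> y\<bar> \<le> 2 * \<omega> / U * dist x y"
    using F.prob_space by simp
qed

text \<open>Atomlessness is required of the limit pacing function alone, so one null set of items
  serves all \<open>k\<close>.\<close>

lemma mean_surplus_tendsto:
  assumes \<mu>k: "\<And>k. pacing (\<mu>k k)" and \<mu>: "pacing \<mu>"
    and lim: "AE \<theta> in G. (\<lambda>k. \<mu>k k \<theta>) \<longlonglongrightarrow> \<mu> \<theta>"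
  shows "(\<lambda>k. mean_surplus (\<mu>k k) x) \<longlonglongrightarrow> mean_surplus \<mu> x"
  unfolding mean_surplus_def
proof (rule integral_dominated_convergence[where w="\<lambda>_. \<omega>"])
  show "AE \<alpha> in F. (\<lambda>k. buyer_surplus (\<mu>k k) \<alpha> (min (x \<bullet> \<alpha>) \<omega>)) \<longlonglongrightarrow> buyer_surplus \<mu> \<alpha> (min (x \<bullet> \<alpha>) \<omega>)"
    by (rule eventually_mono[OF AE_paced_atomless[OF \<mu>]]) (rule buyer_surplus_tendsto[OF \<mu>k \<mu> lim])
  show "AE \<alpha> in F. norm (buyer_surplus (\<mu>k k) \<alpha> (min (x \<bullet> \<alpha>) \<omega>)) \<le> \<omega>" for k
    by (rule eventually_mono[OF AE_F_A mean_surplus_integrand(2)[OF \<mu>k]])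
qed (auto intro!: mean_surplus_integrand(1) \<mu> \<mu>k)

end

text \<open>The perspective of \<open>f\<close>. For \<open>f = mean_surplus \<mu>\<close> and an
  admissible weight \<open>w\<close> it is the largest expected Lagrangian at multiplier
  \<open>t\<close>, apart from the budget term.\<close>

definition dual_term :: "('w::real_vector \<Rightarrow> real) \<Rightarrow> 'w \<Rightarrow> real \<Rightarrow> real" where
  "dual_term f w t = (1 + t) * f (w /\<^sub>R (1 + t))"

lemma lip_boxD: "f \<in> lip_box L C \<Longrightarrow> \<bar>f x - f y\<bar> \<le> L * dist x y"
  by (simp add: lip_box_def)

lemma lip_box_continuous_on:
  assumes f: "f \<in> lip_box L C" and "0 \<le> L"
  shows "continuous_on S f"
proof -
  have "L-lipschitz_on S f"
    using assms by (intro lipschitz_onI) (auto simp: lip_box_def dist_real_def)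
  then show ?thesis
    by (rule lipschitz_on_continuous_on)
qed

lemma continuous_on_dual_term:
  fixes f :: "'w::real_normed_vector \<Rightarrow> real"
  assumes f: "f \<in> lip_box L C" and "0 \<le> L"
  shows "continuous_on ({0..T} \<times> UNIV) (\<lambda>(t, w). dual_term f w t)"
proof -
  have "continuous_on ({0..T} \<times> UNIV) (\<lambda>z::real \<times> 'w. f (snd z /\<^sub>R (1 + fst z)))"
    by (rule continuous_on_compose2[OF lip_box_continuous_on[OF assms, of UNIV]])
       (auto intro!: continuous_intros)
  then show ?thesis
    unfolding dual_term_def case_prod_unfold by (intro continuous_intros)
qed

text \<open>With \<open>a\<close>, \<open>a'\<close> the scaled arguments, the difference is
  \<open>(t - t') * f a + (1 + t') * (f a - f a')\<close>, and the factor \<open>1 + t'\<close>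
  cancels against the denominator in the distance of \<open>a\<close> and \<open>a'\<close>. The
  constant sees \<open>f\<close> only through \<open>L\<close> and \<open>C\<close>, which provides
  the equicontinuity needed for converging minimisers.\<close>

lemma dual_term_lipschitz:
  fixes f :: "'w::real_normed_vector \<Rightarrow> real"
  assumes f: "f \<in> lip_box L C" and L: "0 \<le> L" and "0 \<le> t" "0 \<le> t'"
  shows "\<bar>dual_term f w t - dual_term f w t'\<bar> \<le> (C + L * norm w) * \<bar>t - t'\<bar>"
proof -
  let ?a = "w /\<^sub>R (1 + t)" and ?a' = "w /\<^sub>R (1 + t')"
  have "dist ?a ?a' = \<bar>inverse (1 + t) - inverse (1 + t')\<bar> * norm w"
    by (simp add: dist_norm flip: scaleR_left_diff_distrib)
  also have "inverse (1 + t) - inverse (1 + t') = (t' - t) / (1 + t) / (1 + t')"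
    using assms by (simp add: field_simps)
  finally have d: "(1 + t') * dist ?a ?a' = \<bar>t - t'\<bar> / (1 + t) * norm w"
    using assms by (simp add: abs_mult abs_minus_commute)
  have "(1 + t') * dist ?a ?a' \<le> \<bar>t - t'\<bar> * norm w"
    unfolding d using assms by (intro mult_right_mono) (auto simp: field_simps)
  then have 1: "L * ((1 + t') * dist ?a ?a') \<le> L * (\<bar>t - t'\<bar> * norm w)"
    using L by (rule mult_left_mono)
  have "\<bar>f ?a - f ?a'\<bar> \<le> L * dist ?a ?a'"
    by (rule lip_boxD[OF f])
  then have "(1 + t') * \<bar>f ?a - f ?a'\<bar> \<le> (1 + t') * (L * dist ?a ?a')"
    using assms by (intro mult_left_mono) auto
  then have 2: "(1 + t') * \<bar>f ?a - f ?a'\<bar> \<le> L * norm w * \<bar>t - t'\<bar>"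
    using 1 by (simp add: mult.assoc mult.left_commute mult.commute[of "norm w"])
  have 3: "\<bar>t - t'\<bar> * \<bar>f ?a\<bar> \<le> \<bar>t - t'\<bar> * C"
    using f by (intro mult_left_mono) (auto simp: lip_box_def)
  have "dual_term f w t - dual_term f w t' = (t - t') * f ?a + (1 + t') * (f ?a - f ?a')"
    by (simp add: dual_term_def algebra_simps)
  also have "\<bar>\<dots>\<bar> \<le> \<bar>t - t'\<bar> * \<bar>f ?a\<bar> + (1 + t') * \<bar>f ?a - f ?a'\<bar>"
    using assms abs_triangle_ineq[of "(t - t') * f ?a" "(1 + t') * (f ?a - f ?a')"] by (simp add: abs_mult)
  also have "\<dots> \<le> (C + L * norm w) * \<bar>t - t'\<bar>"
    using 2 3 by (simp add: algebra_simps)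
  finally show ?thesis .
qed

context auction
begin

text \<open>The dual objective is at most \<open>\<omega>\<close> at \<open>0\<close> and exceeds \<open>\<omega>\<close> from here on, so minimisers over all
  \<open>t \<ge> 0\<close> are interior on the right.\<close>

definition max_multiplier :: real where
  "max_multiplier = \<omega> / Bmin + 1"

definition multiplier :: "(real^'d \<Rightarrow> real) \<Rightarrow> (real^'d) \<times> real \<Rightarrow> real" where
  "multiplier f = least_minimizer max_multiplier (dual_term f)"

lemma max_multiplier_nonneg: "0 \<le> max_multiplier"
  using \<omega>(1) Bmin by (simp add: max_multiplier_def)

lemma lip_const_nonneg: "0 \<le> 2 * \<omega> / U"
  using \<omega>(1) U by simp

lemma multiplier_minimizer:
  assumes "f \<in> lip_box (2 * \<omega> / U) \<omega>"
  shows "minimizer max_multiplier (dual_term f) \<theta> (multiplier f \<theta>)"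
  unfolding multiplier_def
  by (intro minimizer_least max_multiplier_nonneg continuous_on_dual_term[OF assms lip_const_nonneg])

lemma multiplier_measurable:
  assumes "f \<in> lip_box (2 * \<omega> / U) \<omega>"
  shows "multiplier f \<in> borel_measurable borel"
  unfolding multiplier_def
  by (intro borel_measurable_least_minimizer max_multiplier_nonneg continuous_on_dual_term[OF assms lip_const_nonneg])

lemma pacing_multiplier:
  assumes "f \<in> lip_box (2 * \<omega> / U) \<omega>"
  shows "pacing (multiplier f)"
  unfolding pacing_def
proof (intro conjI allI)
  show "multiplier f \<in> borel_measurable G"
    by (rule measurable_compose[OF measurable_ident_G multiplier_measurable[OF assms]])
  show "0 \<le> multiplier f \<theta>" for \<theta>
    using multiplier_minimizer[OF assms, of \<theta>] by (simp add: minimizer_def)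
qed

text \<open>Only the types that are ambiguous for the limit \<open>f\<close> are excluded, and they
  are null for \<open>G\<close> because \<open>G\<close> has a density.\<close>

lemma multiplier_tendsto:
  assumes fk: "\<And>k. fk k \<in> lip_box (2 * \<omega> / U) \<omega>" and f: "f \<in> lip_box (2 * \<omega> / U) \<omega>"
    and lim: "\<And>x. (\<lambda>k. fk k x) \<longlonglongrightarrow> f x"
  shows "AE \<theta> in G. (\<lambda>k. multiplier (fk k) \<theta>) \<longlonglongrightarrow> multiplier f \<theta>"
proof -
  have "ambiguous max_multiplier (dual_term f) \<in> null_sets lebesgue"
    by (intro null_sets_completionI ambiguous_null_sets max_multiplier_nonneg
        continuous_on_dual_term[OF f lip_const_nonneg])
  then have "AE \<theta> in G. \<theta> \<notin> ambiguous max_multiplier (dual_term f)"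
    by (intro AE_density_lebesgue[OF G_dens] AE_not_in)
  then show ?thesis
  proof (rule eventually_mono)
    fix \<theta> assume \<theta>: "\<theta> \<notin> ambiguous max_multiplier (dual_term f)"
    obtain w B where [simp]: "\<theta> = (w, B)"
      by (cases \<theta>)
    show "(\<lambda>k. multiplier (fk k) \<theta>) \<longlonglongrightarrow> multiplier f \<theta>"
      unfolding multiplier_def[of f] \<open>\<theta> = (w, B)\<close>
    proof (rule least_minimizer_tendsto[where G="\<lambda>k. dual_term (fk k)" and M="\<omega> + 2 * \<omega> / U * norm w"])
      show "(\<lambda>k. dual_term (fk k) w t) \<longlonglongrightarrow> dual_term f w t" for t
        unfolding dual_term_def by (intro tendsto_intros lim)
      show "\<bar>dual_term (fk k) w t - dual_term (fk k) w t'\<bar> \<le> (\<omega> + 2 * \<omega> / U * norm w) * \<bar>t - t'\<bar>"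
        if "t \<in> {0..max_multiplier}" "t' \<in> {0..max_multiplier}" for k t t'
        using that by (intro dual_term_lipschitz fk lip_const_nonneg) auto
      show "minimizer max_multiplier (dual_term (fk k)) (w, B) (multiplier (fk k) (w, B))" for k
        by (rule multiplier_minimizer[OF fk])
    qed (use \<theta> max_multiplier_nonneg continuous_on_dual_term[OF f lip_const_nonneg] in auto)
  qed
qed

lemma fixpoint_exists:
  obtains f where "f \<in> lip_box (2 * \<omega> / U) \<omega>" "mean_surplus (multiplier f) = f"
proof (rule schauder_lip_box[where T="\<lambda>f. mean_surplus (multiplier f)" and L="2 * \<omega> / U" and C=\<omega>])
  show "0 \<le> 2 * \<omega> / U" "\<omega> > 0"
    by (rule lip_const_nonneg \<omega>(1))+
  show "mean_surplus (multiplier f) \<in> lip_box (2 * \<omega> / U) \<omega>" if "f \<in> lip_box (2 * \<omega> / U) \<omega>" for f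
    by (intro mean_surplus_in_lip_box pacing_multiplier that)
  show "(\<lambda>k. mean_surplus (multiplier (fk k)) x) \<longlonglongrightarrow> mean_surplus (multiplier f) x"
    if "\<And>k. fk k \<in> lip_box (2 * \<omega> / U) \<omega>" "f \<in> lip_box (2 * \<omega> / U) \<omega>" "\<And>x. (\<lambda>k. fk k x) \<longlonglongrightarrow> f x"
    for fk f x
    by (intro mean_surplus_tendsto pacing_multiplier that multiplier_tendsto)
qed

end

section \<open>Lagrangian duality and the equilibrium\<close>

context auction
begin

definition bid :: "((real^'d) \<times> real \<Rightarrow> real) \<Rightarrow> real^'d \<Rightarrow> real \<Rightarrow> real" where
  "bid \<mu> \<alpha> = real_distribution.fp_bid (paced_dist G \<mu> \<alpha>) (n - 1) (r \<alpha>)"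

definition win_prob :: "((real^'d) \<times> real \<Rightarrow> real) \<Rightarrow> real^'d \<Rightarrow> real \<Rightarrow> real" where
  "win_prob \<mu> \<alpha> b = real_distribution.bid_cdf (paced_dist G \<mu> \<alpha>) (n - 1) (r \<alpha>) b ^ (n - 1)"

definition payment :: "((real^'d) \<times> real \<Rightarrow> real) \<Rightarrow> (real^'d \<Rightarrow> real) \<Rightarrow> real^'d \<Rightarrow> real" where
  "payment \<mu> b \<alpha> = (if r \<alpha> \<le> b \<alpha> then b \<alpha> * win_prob \<mu> \<alpha> (b \<alpha>) else 0)"

definition gross :: "((real^'d) \<times> real \<Rightarrow> real) \<Rightarrow> real^'d \<Rightarrow> (real^'d \<Rightarrow> real) \<Rightarrow> real^'d \<Rightarrow> real" where
  "gross \<mu> w b \<alpha> = (if r \<alpha> \<le> b \<alpha> then (w \<bullet> \<alpha>) * win_prob \<mu> \<alpha> (b \<alpha>) else 0)"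

text \<open>The multiplier \<tau> is free rather than read off from \<mu>, so that bids with
  neighbouring multipliers can be compared with the equilibrium bid against the same rivals.\<close>

definition shaded :: "((real^'d) \<times> real \<Rightarrow> real) \<Rightarrow> real^'d \<Rightarrow> real \<Rightarrow> real^'d \<Rightarrow> real" where
  "shaded \<mu> w \<tau> \<alpha> = bid \<mu> \<alpha> (w \<bullet> \<alpha> / (1 + \<tau>))"

lemma bid_eq:
  assumes "pacing \<mu>"
  shows "bid \<mu> \<alpha> x = (if x < r \<alpha> then x else if cdf (paced_dist G \<mu> \<alpha>) x ^ (n - 1) > 0
    then x - buyer_surplus \<mu> \<alpha> x / cdf (paced_dist G \<mu> \<alpha>) x ^ (n - 1) else r \<alpha>)"
proof -
  interpret real_distribution "paced_dist G \<mu> \<alpha>"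
    by (rule real_distribution_paced[OF assms])
  show ?thesis
    by (simp add: bid_def fp_bid_def top_cdf_def buyer_surplus_def)
qed

lemma vp_strategy_eq:
  assumes "pacing \<mu>"
  shows "vp_strategy n G \<mu> r \<theta> \<alpha> = bid \<mu> \<alpha> (paced_value \<mu> \<alpha> \<theta>)"
proof -
  interpret real_distribution "paced_dist G \<mu> \<alpha>"
    by (rule real_distribution_paced[OF assms])
  have H: "H_cdf n G \<mu> \<alpha> x = top_cdf (n - 1) x" for x
    by (simp add: H_cdf_def top_cdf_def cdf_def2)
  show ?thesis
  proof (cases "r \<alpha> \<le> paced_value \<mu> \<alpha> \<theta>")
    case True
    then have "(LBINT s=r \<alpha>..paced_value \<mu> \<alpha> \<theta>. top_cdf (n - 1) s) = surplus (n - 1) (r \<alpha>) (paced_value \<mu> \<alpha> \<theta>)"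
      by (simp add: interval_integral_Icc surplus_def)
    with True show ?thesis
      by (simp add: vp_strategy_def sigma_fn_def bid_def fp_bid_def H)
  qed (simp add: vp_strategy_def sigma_fn_def bid_def fp_bid_def)
qed

section \<open>Reduction of the auction to integrals over items\<close>

lemma bid_measurable:
  assumes \<mu>: "pacing \<mu>" and f: "f \<in> M \<rightarrow>\<^sub>M F" and x [measurable]: "x \<in> borel_measurable M"
  shows "(\<lambda>z. bid \<mu> (f z) (x z)) \<in> borel_measurable M"
proof -
  have [measurable]: "(\<lambda>z. r (f z)) \<in> borel_measurable M"
    by (rule measurable_compose[OF f r_measurable])
  have [measurable]: "(\<lambda>z. cdf (paced_dist G \<mu> (f z)) (x z)) \<in> borel_measurable M"
    by (intro cdf_paced_measurable \<mu> f x)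
  have [measurable]: "(\<lambda>z. buyer_surplus \<mu> (f z) (x z)) \<in> borel_measurable M"
    by (intro buyer_surplus_measurable \<mu> f x)
  show ?thesis
    unfolding bid_eq[OF \<mu>] by measurable
qed

lemma vp_strategy_measurable:
  assumes "pacing \<mu>" "f \<in> M \<rightarrow>\<^sub>M F" "g \<in> M \<rightarrow>\<^sub>M G"
  shows "(\<lambda>z. vp_strategy n G \<mu> r (g z) (f z)) \<in> borel_measurable M"
  unfolding vp_strategy_eq[OF assms(1)] by (intro bid_measurable paced_value_joint_measurable assms)

lemma win_prob_eq_measure:
  assumes "pacing \<mu>"
  shows "win_prob \<mu> \<alpha> b = measure G {\<theta>. vp_strategy n G \<mu> r \<theta> \<alpha> \<le> b} ^ (n - 1)"
proof -
  interpret real_distribution "paced_dist G \<mu> \<alpha>"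
    by (rule real_distribution_paced[OF assms])
  have "{x. fp_bid (n - 1) (r \<alpha>) x \<le> b} \<in> sets borel"
    by measurable
  from measure_paced_dist[OF assms this, of \<alpha>] show ?thesis
    by (simp add: win_prob_def bid_cdf_def vp_strategy_eq[OF assms] bid_def)
qed

lemma win_prob_range: "pacing \<mu> \<Longrightarrow> win_prob \<mu> \<alpha> b \<in> {0..1}"
  by (auto simp: win_prob_eq_measure intro!: power_le_one)

lemma win_prob_measurable:
  assumes \<mu>: "pacing \<mu>" and b [measurable]: "b \<in> borel_measurable F"
  shows "(\<lambda>\<alpha>. win_prob \<mu> \<alpha> (b \<alpha>)) \<in> borel_measurable F"
proof -
  have [measurable]: "(\<lambda>p. vp_strategy n G \<mu> r (snd p) (fst p)) \<in> borel_measurable (F \<Otimes>\<^sub>M G)"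
    by (intro vp_strategy_measurable \<mu> measurable_fst measurable_snd)
  have "measure G {\<theta>. vp_strategy n G \<mu> r \<theta> \<alpha> \<le> b \<alpha>} =
      (\<integral>\<theta>. (if vp_strategy n G \<mu> r \<theta> \<alpha> \<le> b \<alpha> then 1 else 0) \<partial>G)" for \<alpha>
  proof -
    have "measure G {\<theta>. vp_strategy n G \<mu> r \<theta> \<alpha> \<le> b \<alpha>} =
        (\<integral>\<theta>. indicator {\<theta>. vp_strategy n G \<mu> r \<theta> \<alpha> \<le> b \<alpha>} \<theta> \<partial>G)"
      by simp
    also have "\<dots> = (\<integral>\<theta>. (if vp_strategy n G \<mu> r \<theta> \<alpha> \<le> b \<alpha> then 1 else 0) \<partial>G)"
      by (intro Bochner_Integration.integral_cong) (auto simp: indicator_def)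
    finally show ?thesis .
  qed
  moreover have "(\<lambda>\<alpha>. \<integral>\<theta>. (if vp_strategy n G \<mu> r \<theta> \<alpha> \<le> b \<alpha> then 1 else 0 :: real) \<partial>G) \<in> borel_measurable F"
    by (intro G.borel_measurable_lebesgue_integral) measurable
  ultimately show ?thesis
    unfolding win_prob_eq_measure[OF \<mu>] by simp
qed

lemma payment_measurable:
  assumes \<mu>: "pacing \<mu>" and b [measurable]: "b \<in> borel_measurable F"
  shows "payment \<mu> b \<in> borel_measurable F" "gross \<mu> w b \<in> borel_measurable F"
proof -
  note [measurable] = win_prob_measurable[OF assms]
  show "payment \<mu> b \<in> borel_measurable F"
    unfolding payment_def by measurable
  show "gross \<mu> w b \<in> borel_measurable F"
    unfolding gross_def by measurable
qed

text \<open>Given the item, the rivals are independent, so winning is a product event of probability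
  \<open>win_prob\<close>; Fubini integrates the rivals out. The reward \<open>h\<close> is kept
  general to cover both payment and value.\<close>

lemma nn_integral_wins:
  assumes \<mu>: "pacing \<mu>" and b [measurable]: "b \<in> borel_measurable F" and h [measurable]: "h \<in> borel_measurable F"
  shows "(\<integral>\<^sup>+ z. ennreal (if wins n r (vp_strategy n G \<mu> r) b (fst z) (snd z) then h (fst z) else 0) \<partial>auction_space n F G) =
    (\<integral>\<^sup>+ \<alpha>. ennreal (if r \<alpha> \<le> b \<alpha> then h \<alpha> * win_prob \<mu> \<alpha> (b \<alpha>) else 0) \<partial>F)" (is "?lhs = _")
proof -
  define I where "I = {..<n - 1}"
  define P where "P = (\<Pi>\<^sub>M i\<in>I. G)"
  let ?\<beta> = "vp_strategy n G \<mu> r"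
  interpret P: prob_space P
    unfolding P_def by (intro prob_space_PiM G_prob)
  interpret prod: product_sigma_finite "\<lambda>_. G" ..
  have win_sets: "{z \<in> space (F \<Otimes>\<^sub>M P). wins n r ?\<beta> b (fst z) (snd z)} \<in> sets (F \<Otimes>\<^sub>M P)"
  proof -
    have "{z \<in> space (F \<Otimes>\<^sub>M P). r (fst z) \<le> b (fst z)} \<in> sets (F \<Otimes>\<^sub>M P)"
      by measurable
    moreover have "{z \<in> space (F \<Otimes>\<^sub>M P). \<forall>i\<in>I. ?\<beta> (snd z i) (fst z) \<le> b (fst z)} \<in> sets (F \<Otimes>\<^sub>M P)"
    proof (intro sets.sets_Collect_finite_All borel_measurable_le)
      fix i assume "i \<in> I"
      then have "(\<lambda>z. snd z i) \<in> F \<Otimes>\<^sub>M P \<rightarrow>\<^sub>M G"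
        unfolding P_def by (intro measurable_compose[OF measurable_snd] measurable_component_singleton)
      then show "(\<lambda>z. ?\<beta> (snd z i) (fst z)) \<in> borel_measurable (F \<Otimes>\<^sub>M P)"
        by (intro vp_strategy_measurable \<mu> measurable_fst)
    qed (simp_all add: I_def)
    ultimately have "{z \<in> space (F \<Otimes>\<^sub>M P). r (fst z) \<le> b (fst z) \<and>
        (\<forall>i\<in>I. ?\<beta> (snd z i) (fst z) \<le> b (fst z))} \<in> sets (F \<Otimes>\<^sub>M P)"
      by (rule sets.sets_Collect_conj[rotated])
    then show ?thesis
      by (simp only: wins_def I_def Ball_def lessThan_iff)
  qed
  have inner: "(\<integral>\<^sup>+ \<theta>s. ennreal (if wins n r ?\<beta> b \<alpha> \<theta>s then h \<alpha> else 0) \<partial>P) =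
      ennreal (if r \<alpha> \<le> b \<alpha> then h \<alpha> * win_prob \<mu> \<alpha> (b \<alpha>) else 0)" for \<alpha>
  proof (cases "r \<alpha> \<le> b \<alpha>")
    case True
    define E where "E = {\<theta>. ?\<beta> \<theta> \<alpha> \<le> b \<alpha>}"
    have "(\<lambda>\<theta>. ?\<beta> \<theta> \<alpha>) \<in> borel_measurable G"
      by (intro vp_strategy_measurable \<mu>) auto
    then have E: "E \<in> sets G"
      using measurable_sets[of "\<lambda>\<theta>. ?\<beta> \<theta> \<alpha>" G borel "{..b \<alpha>}"] by (simp add: E_def vimage_def)
    have "emeasure P (PiE I (\<lambda>_. E)) = (\<Prod>i\<in>I. emeasure G E)"
      unfolding P_def using E by (intro prod.emeasure_PiM) (auto simp: I_def)
    also have "\<dots> = ennreal (win_prob \<mu> \<alpha> (b \<alpha>))"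
      by (simp add: I_def G.emeasure_eq_measure win_prob_eq_measure[OF \<mu>] E_def ennreal_power)
    finally have em: "emeasure P (PiE I (\<lambda>_. E)) = ennreal (win_prob \<mu> \<alpha> (b \<alpha>))" .
    have sets: "PiE I (\<lambda>_. E) \<in> sets P"
      unfolding P_def using E by (intro sets_PiM_I_finite) (auto simp: I_def)
    have "(\<integral>\<^sup>+ \<theta>s. ennreal (if wins n r ?\<beta> b \<alpha> \<theta>s then h \<alpha> else 0) \<partial>P) =
        (\<integral>\<^sup>+ \<theta>s. ennreal (h \<alpha>) * indicator (PiE I (\<lambda>_. E)) \<theta>s \<partial>P)"
    proof (intro nn_integral_cong)
      fix \<theta>s assume "\<theta>s \<in> space P"
      \<comment> \<open>Extensionality removes the coordinates outside \<open>I\<close>, so that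
        winning coincides with membership in the product set.\<close>
      then have "\<theta>s \<in> extensional I"
        by (simp add: P_def space_PiM PiE_def)
      then have "wins n r ?\<beta> b \<alpha> \<theta>s \<longleftrightarrow> \<theta>s \<in> PiE I (\<lambda>_. E)"
        using True by (auto simp: wins_def E_def I_def PiE_def)
      then show "ennreal (if wins n r ?\<beta> b \<alpha> \<theta>s then h \<alpha> else 0) = ennreal (h \<alpha>) * indicator (PiE I (\<lambda>_. E)) \<theta>s"
        by (simp add: indicator_def)
    qed
    also have "\<dots> = ennreal (h \<alpha>) * ennreal (win_prob \<mu> \<alpha> (b \<alpha>))"
      using sets by (simp add: nn_integral_cmult_indicator em)
    also have "\<dots> = ennreal (h \<alpha> * win_prob \<mu> \<alpha> (b \<alpha>))"
      using win_prob_range[OF \<mu>, of \<alpha> "b \<alpha>"] by (simp add: ennreal_mult'')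
    finally show ?thesis
      using True by simp
  next
    case False
    then show ?thesis
      by (simp add: wins_def)
  qed
  have "(\<lambda>z. ennreal (if wins n r ?\<beta> b (fst z) (snd z) then h (fst z) else 0)) \<in> borel_measurable (F \<Otimes>\<^sub>M P)"
    using win_sets by (intro measurable_compose[OF _ measurable_ennreal] measurable_If) (auto simp: pred_def)
  then have "?lhs = (\<integral>\<^sup>+ \<alpha>. \<integral>\<^sup>+ \<theta>s. ennreal (if wins n r ?\<beta> b \<alpha> \<theta>s then h \<alpha> else 0) \<partial>P \<partial>F)"
    unfolding auction_space_def P_def[symmetric] I_def[symmetric]
    by (subst P.nn_integral_fst[symmetric]) (simp_all cong: if_cong)
  then show ?thesis
    by (simp add: inner)
qed

lemma exp_payment_eq:
  assumes "pacing \<mu>" "b \<in> borel_measurable F"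
  shows "exp_payment n F G r (vp_strategy n G \<mu> r) b = (\<integral>\<^sup>+ \<alpha>. ennreal (payment \<mu> b \<alpha>) \<partial>F)"
  unfolding exp_payment_def payment_def by (rule nn_integral_wins[OF assms assms(2)])

lemma exp_value_eq:
  assumes "pacing \<mu>" "b \<in> borel_measurable F"
  shows "exp_value n F G r (vp_strategy n G \<mu> r) w b = (\<integral>\<^sup>+ \<alpha>. ennreal (gross \<mu> w b \<alpha>) \<partial>F)"
  unfolding exp_value_def gross_def by (rule nn_integral_wins[OF assms inner_measurable_F])

text \<open>Division by \<open>1 + \<tau>\<close> turns the left side into the utility of a bidder
  with the paced value, to which the best-response bound applies. Bids below the reserve price
  contribute 0, and a surplus is nonnegative.\<close>

lemma lagrangian_le:
  assumes \<mu>: "pacing \<mu>" and "0 \<le> \<tau>"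
  shows "gross \<mu> w b \<alpha> - (1 + \<tau>) * payment \<mu> b \<alpha> \<le> (1 + \<tau>) * buyer_surplus \<mu> \<alpha> (w \<bullet> \<alpha> / (1 + \<tau>))"
proof (cases "r \<alpha> \<le> b \<alpha>")
  case True
  interpret real_distribution "paced_dist G \<mu> \<alpha>"
    by (rule real_distribution_paced[OF \<mu>])
  have "(w \<bullet> \<alpha> / (1 + \<tau>) - b \<alpha>) * win_prob \<mu> \<alpha> (b \<alpha>) \<le> buyer_surplus \<mu> \<alpha> (w \<bullet> \<alpha> / (1 + \<tau>))"
    unfolding win_prob_def buyer_surplus_def by (rule fp_bid_best_response[OF True])
  then have "(1 + \<tau>) * ((w \<bullet> \<alpha> / (1 + \<tau>) - b \<alpha>) * win_prob \<mu> \<alpha> (b \<alpha>)) \<le>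
      (1 + \<tau>) * buyer_surplus \<mu> \<alpha> (w \<bullet> \<alpha> / (1 + \<tau>))"
    using assms(2) by (intro mult_left_mono) auto
  moreover have "(1 + \<tau>) * ((w \<bullet> \<alpha> / (1 + \<tau>) - b \<alpha>) * win_prob \<mu> \<alpha> (b \<alpha>)) =
      gross \<mu> w b \<alpha> - (1 + \<tau>) * payment \<mu> b \<alpha>"
    using True assms(2) by (simp add: gross_def payment_def field_simps)
  ultimately show ?thesis by simp
next
  case False
  then show ?thesis
    using assms buyer_surplus_bounds(1)[OF \<mu>] by (simp add: gross_def payment_def)
qed

lemma payment_shaded:
  assumes \<mu>: "pacing \<mu>"
  shows "payment \<mu> (shaded \<mu> w \<tau>) \<alpha> =
    real_distribution.fp_payment (paced_dist G \<mu> \<alpha>) (n - 1) (r \<alpha>) (w \<bullet> \<alpha> / (1 + \<tau>))"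
proof -
  interpret real_distribution "paced_dist G \<mu> \<alpha>"
    by (rule real_distribution_paced[OF \<mu>])
  show ?thesis
    using fp_bid_bounds(1)[of "r \<alpha>" "w \<bullet> \<alpha> / (1 + \<tau>)" "n - 1"] fp_bid_win_prob[of "r \<alpha>" "w \<bullet> \<alpha> / (1 + \<tau>)" "n - 1"]
    by (cases "w \<bullet> \<alpha> / (1 + \<tau>) < r \<alpha>")
       (auto simp: payment_def shaded_def bid_def fp_payment_def win_prob_def, simp_all add: fp_bid_def)
qed

text \<open>The bound is attained because the paced bid wins with probability exactly
  \<open>top_cdf\<close>, even at atoms. Below the reserve price both sides vanish.\<close>

lemma lagrangian_shaded:
  assumes \<mu>: "pacing \<mu>" and "0 \<le> \<tau>"
  shows "gross \<mu> w (shaded \<mu> w \<tau>) \<alpha> - (1 + \<tau>) * payment \<mu> (shaded \<mu> w \<tau>) \<alpha> =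
    (1 + \<tau>) * buyer_surplus \<mu> \<alpha> (w \<bullet> \<alpha> / (1 + \<tau>))"
proof -
  interpret real_distribution "paced_dist G \<mu> \<alpha>"
    by (rule real_distribution_paced[OF \<mu>])
  let ?x = "w \<bullet> \<alpha> / (1 + \<tau>)"
  show ?thesis
  proof (cases "r \<alpha> \<le> ?x")
    case True
    have rb: "r \<alpha> \<le> bid \<mu> \<alpha> ?x"
      unfolding bid_def by (rule fp_bid_bounds(1)[OF True])
    have win: "win_prob \<mu> \<alpha> (bid \<mu> \<alpha> ?x) = top_cdf (n - 1) ?x"
      unfolding win_prob_def bid_def by (rule fp_bid_win_prob[OF True])
    have "(?x - bid \<mu> \<alpha> ?x) * top_cdf (n - 1) ?x = buyer_surplus \<mu> \<alpha> ?x"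
      unfolding bid_def buyer_surplus_def by (rule fp_bid_surplus[OF True])
    then have "(1 + \<tau>) * ((?x - bid \<mu> \<alpha> ?x) * top_cdf (n - 1) ?x) = (1 + \<tau>) * buyer_surplus \<mu> \<alpha> ?x"
      by simp
    then show ?thesis
      using rb assms(2) by (simp add: gross_def payment_def shaded_def win left_diff_distrib right_diff_distrib)
  next
    case False
    then have "bid \<mu> \<alpha> ?x = ?x"
      by (simp add: bid_def fp_bid_def)
    then show ?thesis
      using False by (simp add: gross_def payment_def shaded_def buyer_surplus_def)
  qed
qed

lemma shaded_measurable:
  assumes "pacing \<mu>"
  shows "shaded \<mu> w \<tau> \<in> borel_measurable F"
  unfolding shaded_def by (intro bid_measurable assms) auto

lemma value_bounds:
  assumes "w \<in> Theta_w U" "\<alpha> \<in> A"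
  shows "0 \<le> w \<bullet> \<alpha>" "w \<bullet> \<alpha> \<le> \<omega>"
proof -
  show "0 \<le> w \<bullet> \<alpha>"
    unfolding inner_vec_def using assms A_pos
    by (intro sum_nonneg) (auto simp: Theta_w_def less_imp_le)
  show "w \<bullet> \<alpha> \<le> \<omega>"
    using assms \<omega>(2) by blast
qed

lemma paced_le_value:
  assumes "w \<in> Theta_w U" "\<alpha> \<in> A" "0 \<le> \<tau>"
  shows "w \<bullet> \<alpha> / (1 + \<tau>) \<in> {0..\<omega>}"
proof -
  have "w \<bullet> \<alpha> / (1 + \<tau>) \<le> w \<bullet> \<alpha> / 1"
    using value_bounds(1)[OF assms(1,2)] assms(3) by (intro divide_left_mono) auto
  then show ?thesis
    using value_bounds[OF assms(1,2)] assms(3) by auto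
qed

lemma gross_bounds:
  assumes \<mu>: "pacing \<mu>" and w: "w \<in> Theta_w U" and \<alpha>: "\<alpha> \<in> A"
  shows "0 \<le> gross \<mu> w b \<alpha>" "gross \<mu> w b \<alpha> \<le> \<omega>"
proof -
  have W: "0 \<le> win_prob \<mu> \<alpha> (b \<alpha>)" "win_prob \<mu> \<alpha> (b \<alpha>) \<le> 1"
    using win_prob_range[OF \<mu>, of \<alpha> "b \<alpha>"] by auto
  note v = value_bounds[OF w \<alpha>]
  show "0 \<le> gross \<mu> w b \<alpha>"
    using W v by (simp add: gross_def)
  have "(w \<bullet> \<alpha>) * win_prob \<mu> \<alpha> (b \<alpha>) \<le> \<omega> * 1"
    using W v by (intro mult_mono) auto
  then show "gross \<mu> w b \<alpha> \<le> \<omega>"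
    using \<omega>(1) by (simp add: gross_def)
qed

lemma gross_integrable:
  assumes \<mu>: "pacing \<mu>" and w: "w \<in> Theta_w U" and b: "b \<in> borel_measurable F"
  shows "integrable F (gross \<mu> w b)"
proof (rule F.integrable_const_bound[where B=\<omega>])
  show "AE \<alpha> in F. norm (gross \<mu> w b \<alpha>) \<le> \<omega>"
    using AE_F_A by (rule eventually_mono) (use gross_bounds[OF \<mu> w] in simp)
qed (rule payment_measurable[OF \<mu> b])

lemma payment_shaded_bounds:
  assumes \<mu>: "pacing \<mu>" and w: "w \<in> Theta_w U" and \<alpha>: "\<alpha> \<in> A" and "0 \<le> \<tau>"
  shows "0 \<le> payment \<mu> (shaded \<mu> w \<tau>) \<alpha>" "payment \<mu> (shaded \<mu> w \<tau>) \<alpha> \<le> \<omega>"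
proof -
  interpret real_distribution "paced_dist G \<mu> \<alpha>"
    by (rule real_distribution_paced[OF \<mu>])
  have r: "0 \<le> r \<alpha>"
    using r_pos \<alpha> by (simp add: less_imp_le)
  show "0 \<le> payment \<mu> (shaded \<mu> w \<tau>) \<alpha>" "payment \<mu> (shaded \<mu> w \<tau>) \<alpha> \<le> \<omega>"
    unfolding payment_shaded[OF \<mu>]
    using fp_payment_bounds[OF r, of "n - 1" "w \<bullet> \<alpha> / (1 + \<tau>)"] paced_le_value[OF w \<alpha> \<open>0 \<le> \<tau>\<close>] \<omega>(1) by auto
qed

lemma payment_shaded_integrable:
  assumes \<mu>: "pacing \<mu>" and w: "w \<in> Theta_w U" and \<tau>: "0 \<le> \<tau>"
  shows "integrable F (payment \<mu> (shaded \<mu> w \<tau>))"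
proof (rule F.integrable_const_bound[where B=\<omega>])
  show "AE \<alpha> in F. norm (payment \<mu> (shaded \<mu> w \<tau>) \<alpha>) \<le> \<omega>"
    using AE_F_A by (rule eventually_mono) (use payment_shaded_bounds[OF \<mu> w _ \<tau>] in simp)
qed (rule payment_measurable[OF \<mu> shaded_measurable[OF \<mu>]])

lemma dual_term_mean_surplus:
  assumes \<mu>: "pacing \<mu>" and w: "w \<in> Theta_w U" and \<tau>: "0 \<le> \<tau>"
  shows "integrable F (\<lambda>\<alpha>. (1 + \<tau>) * buyer_surplus \<mu> \<alpha> (w \<bullet> \<alpha> / (1 + \<tau>)))" (is ?int)
    and "dual_term (mean_surplus \<mu>) w \<tau> = (\<integral>\<alpha>. (1 + \<tau>) * buyer_surplus \<mu> \<alpha> (w \<bullet> \<alpha> / (1 + \<tau>)) \<partial>F)" (is ?eq)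
proof -
  have meas: "(\<lambda>\<alpha>. buyer_surplus \<mu> \<alpha> (w \<bullet> \<alpha> / (1 + \<tau>))) \<in> borel_measurable F"
    by (intro buyer_surplus_measurable \<mu>) auto
  have AE: "AE \<alpha> in F. buyer_surplus \<mu> \<alpha> (min ((w /\<^sub>R (1 + \<tau>)) \<bullet> \<alpha>) \<omega>) = buyer_surplus \<mu> \<alpha> (w \<bullet> \<alpha> / (1 + \<tau>))"
    using AE_F_A
  proof (rule eventually_mono)
    fix \<alpha> assume "\<alpha> \<in> A"
    then have "w \<bullet> \<alpha> / (1 + \<tau>) \<le> \<omega>"
      using paced_le_value[OF w _ \<tau>] by simp
    then have "min ((w /\<^sub>R (1 + \<tau>)) \<bullet> \<alpha>) \<omega> = w \<bullet> \<alpha> / (1 + \<tau>)"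
      by (simp add: divide_inverse_commute)
    then show "buyer_surplus \<mu> \<alpha> (min ((w /\<^sub>R (1 + \<tau>)) \<bullet> \<alpha>) \<omega>) = buyer_surplus \<mu> \<alpha> (w \<bullet> \<alpha> / (1 + \<tau>))"
      by simp
  qed
  have "integrable F (\<lambda>\<alpha>. buyer_surplus \<mu> \<alpha> (w \<bullet> \<alpha> / (1 + \<tau>)))"
    using mean_surplus_integrable[OF \<mu>, of "w /\<^sub>R (1 + \<tau>)"] integrable_cong_AE[OF mean_surplus_integrand(1)[OF \<mu>] meas AE]
    by simp
  then show ?int
    by simp
  have "mean_surplus \<mu> (w /\<^sub>R (1 + \<tau>)) = (\<integral>\<alpha>. buyer_surplus \<mu> \<alpha> (w \<bullet> \<alpha> / (1 + \<tau>)) \<partial>F)"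
    unfolding mean_surplus_def by (rule integral_cong_AE[OF mean_surplus_integrand(1)[OF \<mu>] meas AE])
  then show ?eq
    by (simp add: dual_term_def)
qed

text \<open>The itemwise bound integrated. The budget stays out of \<open>dual_term\<close>, so the
  inequality also serves bids that overspend, as trial bids in the slackness argument may.\<close>

lemma weak_duality:
  assumes \<mu>: "pacing \<mu>" and w: "w \<in> Theta_w U" and \<tau>: "0 \<le> \<tau>"
    and b: "b \<in> borel_measurable F" and int: "integrable F (payment \<mu> b)"
  shows "(\<integral>\<alpha>. gross \<mu> w b \<alpha> \<partial>F) - (1 + \<tau>) * (\<integral>\<alpha>. payment \<mu> b \<alpha> \<partial>F) \<le> dual_term (mean_surplus \<mu>) w \<tau>"
proof -
  have "(\<integral>\<alpha>. gross \<mu> w b \<alpha> \<partial>F) - (1 + \<tau>) * (\<integral>\<alpha>. payment \<mu> b \<alpha> \<partial>F) =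
      (\<integral>\<alpha>. gross \<mu> w b \<alpha> - (1 + \<tau>) * payment \<mu> b \<alpha> \<partial>F)"
    using int gross_integrable[OF \<mu> w b] by simp
  also have "\<dots> \<le> dual_term (mean_surplus \<mu>) w \<tau>"
    unfolding dual_term_mean_surplus(2)[OF \<mu> w \<tau>]
    using int gross_integrable[OF \<mu> w b]
    by (intro integral_mono lagrangian_le[OF \<mu> \<tau>] dual_term_mean_surplus(1)[OF \<mu> w \<tau>]) auto
  finally show ?thesis .
qed

lemma strong_duality:
  assumes \<mu>: "pacing \<mu>" and w: "w \<in> Theta_w U" and \<tau>: "0 \<le> \<tau>"
  shows "(\<integral>\<alpha>. gross \<mu> w (shaded \<mu> w \<tau>) \<alpha> \<partial>F) - (1 + \<tau>) * (\<integral>\<alpha>. payment \<mu> (shaded \<mu> w \<tau>) \<alpha> \<partial>F) =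
    dual_term (mean_surplus \<mu>) w \<tau>"
proof -
  have "(\<integral>\<alpha>. gross \<mu> w (shaded \<mu> w \<tau>) \<alpha> \<partial>F) - (1 + \<tau>) * (\<integral>\<alpha>. payment \<mu> (shaded \<mu> w \<tau>) \<alpha> \<partial>F) =
      (\<integral>\<alpha>. gross \<mu> w (shaded \<mu> w \<tau>) \<alpha> - (1 + \<tau>) * payment \<mu> (shaded \<mu> w \<tau>) \<alpha> \<partial>F)"
    using payment_shaded_integrable[OF \<mu> w \<tau>] gross_integrable[OF \<mu> w shaded_measurable[OF \<mu>]] by simp
  then show ?thesis
    by (simp add: lagrangian_shaded[OF \<mu> \<tau>] dual_term_mean_surplus(2)[OF \<mu> w \<tau>])
qed

text \<open>At one item the payment can jump only at an atom of the paced value or at the reserve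
  price; both are excluded for almost every item.\<close>

lemma mean_payment_tendsto:
  assumes \<mu>: "pacing \<mu>" and w: "w \<in> Theta_w U" and \<tau>: "0 \<le> \<tau>"
    and ne: "AE \<alpha> in F. w \<bullet> \<alpha> / (1 + \<tau>) \<noteq> r \<alpha>"
    and s: "\<And>k. 0 \<le> s k" "s \<longlonglongrightarrow> \<tau>"
  shows "(\<lambda>k. \<integral>\<alpha>. payment \<mu> (shaded \<mu> w (s k)) \<alpha> \<partial>F) \<longlonglongrightarrow> (\<integral>\<alpha>. payment \<mu> (shaded \<mu> w \<tau>) \<alpha> \<partial>F)"
proof (rule integral_dominated_convergence[where w="\<lambda>_. \<omega>"])
  show "payment \<mu> (shaded \<mu> w \<tau>) \<in> borel_measurable F" "payment \<mu> (shaded \<mu> w (s k)) \<in> borel_measurable F" for k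
    by (intro payment_measurable \<mu> shaded_measurable)+
  show "AE \<alpha> in F. norm (payment \<mu> (shaded \<mu> w (s k)) \<alpha>) \<le> \<omega>" for k
    using AE_F_A by (rule eventually_mono) (use payment_shaded_bounds[OF \<mu> w _ s(1)] in simp)
  show "AE \<alpha> in F. (\<lambda>k. payment \<mu> (shaded \<mu> w (s k)) \<alpha>) \<longlonglongrightarrow> payment \<mu> (shaded \<mu> w \<tau>) \<alpha>"
    using AE_paced_atomless[OF \<mu>] ne
  proof eventually_elim
    case (elim \<alpha>)
    interpret real_distribution "paced_dist G \<mu> \<alpha>"
      by (rule real_distribution_paced[OF \<mu>])
    let ?x = "w \<bullet> \<alpha> / (1 + \<tau>)"
    have "measure (paced_dist G \<mu> \<alpha>) {?x} = measure G {\<theta>. paced_value \<mu> \<alpha> \<theta> = ?x}"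
      using measure_paced_dist[OF \<mu>, of "{?x}" \<alpha>] by simp
    also have "\<dots> = 0"
    proof -
      have "AE \<theta> in G. paced_value \<mu> \<alpha> \<theta> \<noteq> ?x"
        using elim(1) by blast
      then have "AE \<theta> in G. \<theta> \<notin> {\<theta>. paced_value \<mu> \<alpha> \<theta> = ?x}"
        by simp
      then show ?thesis
        by (intro measure_eq_0_null_sets AE_iff_null_sets[THEN iffD2])
           (use measurable_sets[OF paced_value_measurable[OF \<mu>, of \<alpha>], of "{?x}"] in \<open>simp_all add: vimage_def\<close>)
    qed
    finally have "measure (paced_dist G \<mu> \<alpha>) {?x} = 0" .
    moreover have "(\<lambda>k. w \<bullet> \<alpha> / (1 + s k)) \<longlonglongrightarrow> ?x"
      using \<tau> by (intro tendsto_intros s) auto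
    ultimately show ?case
      unfolding payment_shaded[OF \<mu>] by (intro fp_payment_tendsto elim)
  qed
qed simp_all

lemma complementary_slackness:
  assumes f: "f \<in> lip_box (2 * \<omega> / U) \<omega>" and fp: "mean_surplus (multiplier f) = f"
    and \<theta>: "(w, B) \<in> Theta U Bmin" and ne: "AE \<alpha> in F. paced_value (multiplier f) \<alpha> (w, B) \<noteq> r \<alpha>"
  defines "t \<equiv> multiplier f (w, B)"
  defines "P \<equiv> (\<integral>\<alpha>. payment (multiplier f) (shaded (multiplier f) w t) \<alpha> \<partial>F)"
  shows "P \<le> B" "t * (B - P) = 0"
proof -
  let ?\<mu> = "multiplier f"
  define Q where "Q s = (\<integral>\<alpha>. payment ?\<mu> (shaded ?\<mu> w s) \<alpha> \<partial>F)" for s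
  have \<mu>: "pacing ?\<mu>"
    by (rule pacing_multiplier[OF f])
  have w: "w \<in> Theta_w U" and B: "Bmin < B"
    using \<theta> by (auto simp: Theta_def)
  have t0: "0 \<le> t"
    unfolding t_def by (rule pacing_nonneg[OF \<mu>])
  have min: "dual_term f w t + t * B \<le> dual_term f w s + s * B" if "s \<in> {0..max_multiplier}" for s
    using multiplier_minimizer[OF f, of "(w, B)"] that by (simp add: minimizer_def t_def)
  \<comment> \<open>The bid with multiplier \<open>s\<close> is measured by weak duality at
    \<open>t\<close> and by strong duality at \<open>s\<close>. Its value \<open>?V\<close> cancels
    when both are inserted into the optimality of \<open>t\<close> over \<open>s\<close>.\<close>
  have slope: "0 \<le> (s - t) * (B - Q s)" if s: "s \<in> {0..max_multiplier}" for s
  proof -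
    have s0: "0 \<le> s" using s by simp
    let ?V = "\<integral>\<alpha>. gross ?\<mu> w (shaded ?\<mu> w s) \<alpha> \<partial>F"
    have "?V - (1 + t) * Q s \<le> dual_term f w t"
      using weak_duality[OF \<mu> w t0 shaded_measurable[OF \<mu>] payment_shaded_integrable[OF \<mu> w s0]]
      by (simp add: Q_def fp)
    moreover have "?V - (1 + s) * Q s = dual_term f w s"
      using strong_duality[OF \<mu> w s0] by (simp add: Q_def fp)
    ultimately show ?thesis
      using min[OF s] by (simp add: algebra_simps)
  qed
  have lim: "(\<lambda>k. Q (s k)) \<longlonglongrightarrow> P" if "\<And>k. 0 \<le> s k" "s \<longlonglongrightarrow> t" for s
    unfolding P_def Q_def
    by (intro mean_payment_tendsto \<mu> w t0 that) (use ne in \<open>simp add: paced_value_def t_def\<close>)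
  \<comment> \<open>Room to the right of \<open>t\<close> is needed: the inequality
    \<open>P \<le> B\<close> comes from admissible multipliers \<open>s > t\<close>.\<close>
  have t_less: "t < max_multiplier"
  proof (rule ccontr)
    assume "\<not> t < max_multiplier"
    then have "max_multiplier \<le> t" by simp
    then have "max_multiplier * Bmin \<le> t * B"
      using B Bmin t0 by (intro mult_mono) auto
    moreover have "max_multiplier * Bmin = \<omega> + Bmin"
      using Bmin by (simp add: max_multiplier_def field_simps)
    moreover have "0 \<le> dual_term f w t" "dual_term f w 0 \<le> \<omega>"
      using f t0 by (auto simp: lip_box_def dual_term_def)
    ultimately show False
      using min[of 0] max_multiplier_nonneg Bmin by simp
  qed
  show "P \<le> B"
  proof (rule LIMSEQ_le_const2)
    \<comment> \<open>Decreases from \<open>max_multiplier\<close> to \<open>t\<close>; to the right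
      of \<open>t\<close> the slope inequality says that the payment is within budget.\<close>
    define s where "s k = t + (max_multiplier - t) / real (Suc k)" for k
    have s_gt: "t < s k" for k
      using t_less by (simp add: s_def)
    have s_le: "s k \<le> max_multiplier" for k
    proof -
      have "(max_multiplier - t) / real (Suc k) \<le> (max_multiplier - t) / 1"
        using t_less by (intro divide_left_mono) auto
      then show ?thesis by (simp add: s_def)
    qed
    have "s \<longlonglongrightarrow> t + 0"
      unfolding s_def by (intro tendsto_intros LIMSEQ_Suc[OF lim_const_over_n])
    then show "(\<lambda>k. Q (s k)) \<longlonglongrightarrow> P"
      using t0 s_gt by (intro lim) (auto intro: order_trans less_imp_le)
    have "Q (s k) \<le> B" for k
      using slope[of "s k"] s_gt[of k] s_le[of k] t0 by (simp add: zero_le_mult_iff)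
    then show "\<exists>N. \<forall>k\<ge>N. Q (s k) \<le> B"
      by blast
  qed
  moreover have "B \<le> P" if "0 < t"
  proof (rule LIMSEQ_le_const)
    \<comment> \<open>Increases from 0 to \<open>t\<close>. To the left of \<open>t\<close> the sign
      flips and the budget is exhausted; for \<open>t = 0\<close> there is no left side and
      slackness is trivial.\<close>
    define s where "s k = t - t / real (Suc k)" for k
    have s_less: "s k < t" for k
      using that by (simp add: s_def)
    have s0: "0 \<le> s k" for k
    proof -
      have "t / real (Suc k) \<le> t / 1"
        using that by (intro divide_left_mono) auto
      then show ?thesis by (simp add: s_def)
    qed
    have "s \<longlonglongrightarrow> t - 0"
      unfolding s_def by (intro tendsto_intros LIMSEQ_Suc[OF lim_const_over_n])
    then show "(\<lambda>k. Q (s k)) \<longlonglongrightarrow> P"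
      by (intro lim s0) simp
    have "B \<le> Q (s k)" for k
      using slope[of "s k"] s0[of k] s_less[of k] t_less by (simp add: zero_le_mult_iff)
    then show "\<exists>N. \<forall>k\<ge>N. B \<le> Q (s k)"
      by blast
  qed
  ultimately show "t * (B - P) = 0"
    using t0 by force
qed

lemma enn2real_nn_integral:
  assumes "h \<in> borel_measurable F" "AE \<alpha> in F. 0 \<le> h \<alpha>"
  shows "enn2real (\<integral>\<^sup>+ \<alpha>. ennreal (h \<alpha>) \<partial>F) = (\<integral>\<alpha>. h \<alpha> \<partial>F)"
  using assms by (simp add: integral_eq_nn_integral)

lemma fixpoint_SFPE:
  assumes f: "f \<in> lip_box (2 * \<omega> / U) \<omega>" and fp: "mean_surplus (multiplier f) = f"
  shows "is_SFPE n F G A r (vp_strategy n G (multiplier f) r)"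
proof -
  let ?\<mu> = "multiplier f"
  let ?\<beta> = "vp_strategy n G ?\<mu> r"
  have \<mu>: "pacing ?\<mu>"
    by (rule pacing_multiplier[OF f])
  \<comment> \<open>Atomlessness at the level \<open>r \<alpha>\<close>, with the quantifiers
    exchanged, says that almost every buyer meets the reserve price exactly only on a null set of
    items. This is the side condition of the slackness lemma.\<close>
  have "AE \<alpha> in F. AE \<theta> in G. paced_value ?\<mu> \<alpha> \<theta> \<noteq> r \<alpha>"
    using AE_paced_atomless[OF \<mu>] by (rule eventually_mono) blast
  moreover have "{z \<in> space (F \<Otimes>\<^sub>M G). paced_value ?\<mu> (fst z) (snd z) \<noteq> r (fst z)} \<in> sets (F \<Otimes>\<^sub>M G)"
  proof -
    have [measurable]: "(\<lambda>z. paced_value ?\<mu> (fst z) (snd z)) \<in> borel_measurable (F \<Otimes>\<^sub>M G)"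
      by (intro paced_value_joint_measurable \<mu> measurable_fst measurable_snd)
    show ?thesis by measurable
  qed
  ultimately have "AE \<theta> in G. AE \<alpha> in F. paced_value ?\<mu> \<alpha> \<theta> \<noteq> r \<alpha>"
    by (subst (asm) FG.AE_commute) simp_all
  then show ?thesis
    unfolding is_SFPE_def using AE_G_Theta
  proof eventually_elim
    case (elim \<theta>)
    obtain w B where \<theta>: "\<theta> = (w, B)"
      by (cases \<theta>)
    define t where "t = ?\<mu> \<theta>"
    have w: "w \<in> Theta_w U" and B: "0 < B"
      using elim(2) Bmin by (auto simp: Theta_def \<theta>)
    have t0: "0 \<le> t"
      unfolding t_def by (rule pacing_nonneg[OF \<mu>])
    have \<beta>: "?\<beta> \<theta> = shaded ?\<mu> w t"
      by (rule ext) (simp add: vp_strategy_eq[OF \<mu>] shaded_def paced_value_def t_def \<theta>)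
    note slack = complementary_slackness[OF f fp, of w B, folded \<theta>, OF elim(2) elim(1), folded t_def]
    let ?P = "\<integral>\<alpha>. payment ?\<mu> (shaded ?\<mu> w t) \<alpha> \<partial>F"
    let ?V = "\<integral>\<alpha>. gross ?\<mu> w (shaded ?\<mu> w t) \<alpha> \<partial>F"
    have int: "integrable F (payment ?\<mu> (shaded ?\<mu> w t))"
      by (rule payment_shaded_integrable[OF \<mu> w t0])
    have nonneg: "AE \<alpha> in F. 0 \<le> payment ?\<mu> (shaded ?\<mu> w t) \<alpha>"
      by (rule eventually_mono[OF AE_F_A payment_shaded_bounds(1)[OF \<mu> w _ t0]])
    have gross_nonneg: "AE \<alpha> in F. 0 \<le> gross ?\<mu> w b \<alpha>" for b
      by (rule eventually_mono[OF AE_F_A gross_bounds(1)[OF \<mu> w]])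
    have util: "exp_utility n F G r ?\<beta> w b = (\<integral>\<alpha>. gross ?\<mu> w b \<alpha> \<partial>F) - (\<integral>\<alpha>. payment ?\<mu> b \<alpha> \<partial>F)"
      if b: "b \<in> borel_measurable F" and "AE \<alpha> in F. 0 \<le> payment ?\<mu> b \<alpha>" for b
      unfolding exp_utility_def exp_value_eq[OF \<mu> b] exp_payment_eq[OF \<mu> b]
      using that gross_nonneg payment_measurable[OF \<mu> b] by (simp add: enn2real_nn_integral)
    show ?case
    proof (intro conjI allI impI)
      have "exp_payment n F G r ?\<beta> (?\<beta> \<theta>) = ennreal ?P"
        unfolding \<beta> exp_payment_eq[OF \<mu> shaded_measurable[OF \<mu>]] by (rule nn_integral_eq_integral[OF int nonneg])
      moreover have "0 \<le> ?\<beta> \<theta> \<alpha>" if \<alpha>: "\<alpha> \<in> A" for \<alpha>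
      proof -
        interpret real_distribution "paced_dist G ?\<mu> \<alpha>"
          by (rule real_distribution_paced[OF \<mu>])
        show ?thesis
          unfolding \<beta> shaded_def bid_def
          using fp_bid_bounds(1)[of "r \<alpha>" "w \<bullet> \<alpha> / (1 + t)" "n - 1"] paced_le_value[OF w \<alpha> t0] r_pos \<alpha>
          by (cases "r \<alpha> \<le> w \<bullet> \<alpha> / (1 + t)") (force, simp add: fp_bid_def)
      qed
      moreover have "?\<beta> \<theta> \<in> borel_measurable lebesgue"
        unfolding \<beta> using shaded_measurable[OF \<mu>] by (simp add: measurable_cong_sets[OF sets_F refl])
      ultimately show "feasible_bid n F G A r ?\<beta> (snd \<theta>) (?\<beta> \<theta>)"
        using slack(1) by (simp add: feasible_bid_def \<theta> ennreal_leI)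
    next
      fix b assume feas: "feasible_bid n F G A r ?\<beta> (snd \<theta>) b"
      have b: "b \<in> borel_measurable F"
        using feas by (simp add: feasible_bid_def measurable_cong_sets[OF sets_F refl])
      have b_nonneg: "AE \<alpha> in F. 0 \<le> payment ?\<mu> b \<alpha>"
        using AE_F_A
      proof (rule eventually_mono)
        fix \<alpha> assume "\<alpha> \<in> A"
        then have "0 \<le> b \<alpha>"
          using feas by (simp add: feasible_bid_def)
        then show "0 \<le> payment ?\<mu> b \<alpha>"
          using win_prob_range[OF \<mu>, of \<alpha> "b \<alpha>"] by (simp add: payment_def)
      qed
      have nn: "(\<integral>\<^sup>+ \<alpha>. ennreal (payment ?\<mu> b \<alpha>) \<partial>F) \<le> ennreal B"
        using feas by (simp add: feasible_bid_def exp_payment_eq[OF \<mu> b] \<theta>)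
      \<comment> \<open>Feasibility makes the expected payment of the rival bid finite, so
        real-valued weak duality applies to it.\<close>
      have b_int: "integrable F (payment ?\<mu> b)"
        using payment_measurable(1)[OF \<mu> b] b_nonneg
        by (rule integrableI_nonneg) (rule le_less_trans[OF nn], simp)
      have b_le: "(\<integral>\<alpha>. payment ?\<mu> b \<alpha> \<partial>F) \<le> B"
        using nn B by (simp add: nn_integral_eq_integral[OF b_int b_nonneg])
      \<comment> \<open>Both bids are compared through the dual value at \<open>t\<close>. The
        remaining terms \<open>t\<close> times payment are ordered because \<open>b\<close> spends
        at most \<open>B\<close>, while the equilibrium bid spends exactly \<open>B\<close> unless
        \<open>t = 0\<close>.\<close>
      have "(\<integral>\<alpha>. gross ?\<mu> w b \<alpha> \<partial>F) - (1 + t) * (\<integral>\<alpha>. payment ?\<mu> b \<alpha> \<partial>F) \<le> ?V - (1 + t) * ?P"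
        using weak_duality[OF \<mu> w t0 b b_int] strong_duality[OF \<mu> w t0] by simp
      moreover have "t * (\<integral>\<alpha>. payment ?\<mu> b \<alpha> \<partial>F) \<le> t * B"
        using b_le t0 by (rule mult_left_mono)
      moreover have "t * B = t * ?P"
        using slack(2) by (simp add: right_diff_distrib)
      ultimately have "(\<integral>\<alpha>. gross ?\<mu> w b \<alpha> \<partial>F) - (\<integral>\<alpha>. payment ?\<mu> b \<alpha> \<partial>F) \<le> ?V - ?P"
        unfolding distrib_right mult_1_left by linarith
      then show "exp_utility n F G r ?\<beta> (fst \<theta>) b \<le> exp_utility n F G r ?\<beta> (fst \<theta>) (?\<beta> \<theta>)"
        unfolding \<beta> by (simp add: \<theta> util[OF b b_nonneg] util[OF shaded_measurable[OF \<mu>] nonneg])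
    qed
  qed
qed

end

theorem theorem1:
  fixes n :: nat and U Bmin \<omega> :: real
    and A :: "(real^'d::finite) set"
    and F :: "(real^'d) measure"
    and G :: "((real^'d) \<times> real) measure"
    and r :: "real^'d \<Rightarrow> real"
  assumes n: "n \<ge> 2"
    and d: "CARD('d) \<ge> 2"
    and U: "U > 0" and Bmin: "Bmin > 0"
    and A_meas: "A \<in> sets lebesgue"
    and A_pos: "\<forall>\<alpha>\<in>A. \<forall>i. 0 < \<alpha> $ i"
    and F_prob: "prob_space F"
    and F_dens: "\<exists>f. f \<in> borel_measurable lebesgue \<and> F = density lebesgue f"
    and F_A: "emeasure F (UNIV - A) = 0"
    and G_prob: "prob_space G"
    and G_dens: "\<exists>g. g \<in> borel_measurable lebesgue \<and> G = density lebesgue g"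
    and G_Theta: "emeasure G (UNIV - Theta U Bmin) = 0"
    and \<omega>: "\<omega> > 0" "\<forall>w\<in>Theta_w U. \<forall>\<alpha>\<in>A. w \<bullet> \<alpha> \<le> \<omega>"
    and r_meas: "r \<in> borel_measurable lebesgue"
    and r_pos: "\<forall>\<alpha>\<in>A. 0 < r \<alpha>"
  shows "\<exists>\<mu>. \<mu> \<in> borel_measurable lebesgue \<and> (\<forall>\<theta>\<in>Theta U Bmin. 0 \<le> \<mu> \<theta>) \<and>
           is_SFPE n F G A r (vp_strategy n G \<mu> r)"
proof -
  interpret auction n U Bmin \<omega> A F G r
    by (rule auction.intro) (fact d U Bmin A_meas A_pos F_prob F_dens F_A G_prob G_dens G_Theta \<omega> r_meas r_pos)+
  obtain f where f: "f \<in> lip_box (2 * \<omega> / U) \<omega>" and fp: "mean_surplus (multiplier f) = f"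
    by (rule fixpoint_exists)
  have \<mu>: "pacing (multiplier f)"
    by (rule pacing_multiplier[OF f])
  have "multiplier f \<in> borel_measurable lebesgue"
    using pacing_measurable[OF \<mu>] by (simp add: measurable_cong_sets[OF sets_G refl])
  moreover have "\<forall>\<theta>\<in>Theta U Bmin. 0 \<le> multiplier f \<theta>"
    by (intro ballI pacing_nonneg[OF \<mu>])
  moreover note fixpoint_SFPE[OF f fp]
  ultimately show ?thesis
    by (intro exI[of _ "multiplier f"] conjI)
qed

end
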